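(* Let $G$ be a finitely generated nilpotent group and $M$ a finitely generated conically pre-ordered commutative monoid. If $\phi$ is a finite, faithful, and inertia-free $(M,G)$-filter, then there exists a bijection between $L(\phi)$ and $G$ that maps a polycyclic generating sequence of $L(\phi)$, as an abelian group, to a polycyclic generating sequence of $G$.
   Context: A conically pre-ordered monoid is a commutative monoid $M$ (written additively) with a pre-order $\preceq$ such that $s\preceq t$, $s'\preceq t'$ imply $s+s'\preceq t+t'$, and with minimal element $0$ (that is, $0\preceq s$ for all $s$, and $s\preceq 0$ only if $s=0$). An $(M,G)$-filter is a function $\phi$ from $M$ to the set of normal subgroups of $G$, $s\mapsto\phi_s$, with $\langle \phi_s: s\neq 0\rangle=G$, $\bigcap_{s\in M}\phi_s=1$, and for all $s,t\in M$: $[\phi_s,\phi_t]\le\phi_{s+t}$, and $s\preceq t\Rightarrow \phi_s\ge\phi_t$. It is finite if $\operatorname{im}(\phi)$ is a finite set. Here $\partial\phi_s=\langle\phi_{s+t}: t\ne 0\rangle$ and $L(\phi)=\bigoplus_{s\ne0}\phi_s/\partial\phi_s$. Inertia-free: let $\mathfrak B_0=\{\langle1\rangle\}$, $\mathfrak B_{i+1}=\{\phi_s : \exists B\subseteq\mathfrak B_i,\ \partial\phi_s=\langle B\rangle\}$, $\mathfrak B=\bigcup_{i\ge0}\mathfrak B_i$; $\phi$ is inertia-free if $\mathfrak B=\operatorname{im}(\phi)$. Faithful: $\operatorname{Lat}(\phi)$ is the closure of $\operatorname{im}(\phi)$ under intersections and products of subgroups. $\phi$ is faithful if there is $\mathcal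 X\subseteq G$ such that (i) $\langle H\cap\mathcal X\rangle=H$ for all $H\in\operatorname{Lat}(\phi)$; (ii) $H\mapsto H\cap\mathcal X$ is a lattice embedding of $\operatorname{Lat}(\phi)$ into the lattice of subsets of $\mathcal X$ (with $\cap,\cup$); (iii) for each $x\in\mathcal X$ there is a unique $s\in M$ with $x\in\phi_s\setminus\partial\phi_s$. A polycyclic generating sequence (pcgs) of a group $G$ is a finite sequence $(a_1,\dots,a_n)$ generating $G$ such that, with $G_i=\langle a_i,\dots,a_n\rangle$ and $G_{n+1}=1$, each $G_{i+1}$ is normal in $G_i$ with $G_i/G_{i+1}$ cyclic. *)

theory Defs
  imports "HOL-Algebra.Algebra"
begin

definition fg_group :: "('a, 'b) monoid_scheme \<Rightarrow> bool" where
  "fg_group G \<longleftrightarrow> (\<exists>S. finite S \<and> S \<subseteq> carrier G \<and> generate G S = carrier G)"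

definition commutator_subgroup :: "('a, 'b) monoid_scheme \<Rightarrow> 'a set \<Rightarrow> 'a set \<Rightarrow> 'a set" where
  "commutator_subgroup G H K =
     generate G {h \<otimes>\<^bsub>G\<^esub> k \<otimes>\<^bsub>G\<^esub> inv\<^bsub>G\<^esub> h \<otimes>\<^bsub>G\<^esub> inv\<^bsub>G\<^esub> k | h k. h \<in> H \<and> k \<in> K}"

primrec lower_central_series :: "('a, 'b) monoid_scheme \<Rightarrow> nat \<Rightarrow> 'a set" where
  "lower_central_series G 0 = carrier G"
| "lower_central_series G (Suc n) =
     commutator_subgroup G (lower_central_series G n) (carrier G)"

definition nilpotent_group :: "('a, 'b) monoid_scheme \<Rightarrow> bool" where
  "nilpotent_group G \<longleftrightarrow> group G \<and> (\<exists>n. lower_central_series G n = {\<one>\<^bsub>G\<^esub>})"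

text \<open>Lists are indexed from 0, so the entry at index \<open>i\<close> together with all later entries is
  \<open>set (drop i as)\<close>; repeated or trivial entries are allowed.\<close>

definition pcgs :: "('a, 'b) monoid_scheme \<Rightarrow> 'a list \<Rightarrow> bool" where
  "pcgs G as \<longleftrightarrow>
     set as \<subseteq> carrier G \<and>
     generate G (set as) = carrier G \<and>
     (\<forall>i < length as.
        generate G (set (drop (Suc i) as)) \<lhd> G\<lparr>carrier := generate G (set (drop i as))\<rparr> \<and>
        cyclic_group (G\<lparr>carrier := generate G (set (drop i as))\<rparr> Mod
                      generate G (set (drop (Suc i) as))))"

text \<open>The monoid is written additively in the literature; here \<open>s \<otimes> t\<close> stands for \<open>s + t\<close>
  and \<open>\<one>\<close> for \<open>0\<close>.\<close>

locale conically_preordered_monoid = comm_monoid M for M (structure) +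
  fixes le :: "'a \<Rightarrow> 'a \<Rightarrow> bool" (infix \<open>\<preceq>\<close> 50)
  assumes le_refl: "reflp_on (carrier M) (\<preceq>)"
    and le_trans: "transp_on (carrier M) (\<preceq>)"
    and le_mult: "\<lbrakk>s \<in> carrier M; t \<in> carrier M; s' \<in> carrier M; t' \<in> carrier M;
                   s \<preceq> t; s' \<preceq> t'\<rbrakk> \<Longrightarrow> s \<otimes> s' \<preceq> t \<otimes> t'"
    and one_le: "s \<in> carrier M \<Longrightarrow> \<one> \<preceq> s"
    and le_one: "\<lbrakk>s \<in> carrier M; s \<preceq> \<one>\<rbrakk> \<Longrightarrow> s = \<one>"

definition fg_monoid :: "('a, 'b) monoid_scheme \<Rightarrow> bool" where
  "fg_monoid M \<longleftrightarrow>
     (\<exists>S. finite S \<and> S \<subseteq> carrier M \<and> (\<forall>N. submonoid N M \<longrightarrow> S \<subseteq> N \<longrightarrow> N = carrier M))"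

locale group_filter =
  conically_preordered_monoid M le + G: group G
  for M :: "('m, 'c) monoid_scheme" (structure)
    and le :: "'m \<Rightarrow> 'm \<Rightarrow> bool" (infix \<open>\<preceq>\<close> 50)
    and G :: "('a, 'b) monoid_scheme" (structure) +
  fixes \<phi> :: "'m \<Rightarrow> 'a set"
  assumes normal: "s \<in> carrier M \<Longrightarrow> \<phi> s \<lhd> G"
    and generates: "generate G (\<Union>s \<in> carrier M - {\<one>\<^bsub>M\<^esub>}. \<phi> s) = carrier G"
    and trivial_Inter: "(\<Inter>s \<in> carrier M. \<phi> s) = {\<one>\<^bsub>G\<^esub>}"
    and commutator: "\<lbrakk>s \<in> carrier M; t \<in> carrier M\<rbrakk>
                     \<Longrightarrow> commutator_subgroup G (\<phi> s) (\<phi> t) \<subseteq> \<phi> (s \<otimes>\<^bsub>M\<^esub> t)"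
    and antimono: "\<lbrakk>s \<in> carrier M; t \<in> carrier M; s \<preceq> t\<rbrakk> \<Longrightarrow> \<phi> t \<subseteq> \<phi> s"

definition finite_filter :: "('m, 'c) monoid_scheme \<Rightarrow> ('m \<Rightarrow> 'a set) \<Rightarrow> bool" where
  "finite_filter M \<phi> \<longleftrightarrow> finite (\<phi> ` carrier M)"

definition filter_boundary ::
    "('m, 'c) monoid_scheme \<Rightarrow> ('a, 'b) monoid_scheme \<Rightarrow> ('m \<Rightarrow> 'a set) \<Rightarrow> 'm \<Rightarrow> 'a set" where
  "filter_boundary M G \<phi> s = generate G (\<Union>t \<in> carrier M - {\<one>\<^bsub>M\<^esub>}. \<phi> (s \<otimes>\<^bsub>M\<^esub> t))"

definition filter_sum ::
    "('m, 'c) monoid_scheme \<Rightarrow> ('a, 'b) monoid_scheme \<Rightarrow> ('m \<Rightarrow> 'a set) \<Rightarrow> ('m \<Rightarrow> 'a set) monoid" where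
  "filter_sum M G \<phi> =
     sum_group (carrier M - {\<one>\<^bsub>M\<^esub>}) (\<lambda>s. G\<lparr>carrier := \<phi> s\<rparr> Mod filter_boundary M G \<phi> s)"

primrec inertia_level ::
    "('m, 'c) monoid_scheme \<Rightarrow> ('a, 'b) monoid_scheme \<Rightarrow> ('m \<Rightarrow> 'a set) \<Rightarrow> nat \<Rightarrow> 'a set set" where
  "inertia_level M G \<phi> 0 = {generate G {\<one>\<^bsub>G\<^esub>}}"
| "inertia_level M G \<phi> (Suc i) =
     {\<phi> s | s. s \<in> carrier M \<and>
        (\<exists>B \<subseteq> inertia_level M G \<phi> i. filter_boundary M G \<phi> s = generate G (\<Union>B))}"

definition inertia_free ::
    "('m, 'c) monoid_scheme \<Rightarrow> ('a, 'b) monoid_scheme \<Rightarrow> ('m \<Rightarrow> 'a set) \<Rightarrow> bool" where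
  "inertia_free M G \<phi> \<longleftrightarrow> (\<Union>i. inertia_level M G \<phi> i) = \<phi> ` carrier M"

inductive_set filter_lattice ::
    "('m, 'c) monoid_scheme \<Rightarrow> ('a, 'b) monoid_scheme \<Rightarrow> ('m \<Rightarrow> 'a set) \<Rightarrow> 'a set set"
  for M :: "('m, 'c) monoid_scheme" and G :: "('a, 'b) monoid_scheme" and \<phi> :: "'m \<Rightarrow> 'a set"
where
  base: "s \<in> carrier M \<Longrightarrow> \<phi> s \<in> filter_lattice M G \<phi>"
| inter: "\<lbrakk>H \<in> filter_lattice M G \<phi>; K \<in> filter_lattice M G \<phi>\<rbrakk>
          \<Longrightarrow> H \<inter> K \<in> filter_lattice M G \<phi>"
| mult: "\<lbrakk>H \<in> filter_lattice M G \<phi>; K \<in> filter_lattice M G \<phi>\<rbrakk>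
         \<Longrightarrow> H <#>\<^bsub>G\<^esub> K \<in> filter_lattice M G \<phi>"

text \<open>In the lattice of normal subgroups, and hence in \<^const>\<open>filter_lattice\<close>, the meet is
  intersection and the join is the product; the second to fourth conditions below therefore
  state that \<open>H \<mapsto> H \<inter> Y\<close> is injective and preserves meets and joins.\<close>

definition faithful_filter ::
    "('m, 'c) monoid_scheme \<Rightarrow> ('a, 'b) monoid_scheme \<Rightarrow> ('m \<Rightarrow> 'a set) \<Rightarrow> bool" where
  "faithful_filter M G \<phi> \<longleftrightarrow> (\<exists>Y \<subseteq> carrier G.
     (\<forall>H \<in> filter_lattice M G \<phi>. generate G (H \<inter> Y) = H) \<and>
     inj_on (\<lambda>H. H \<inter> Y) (filter_lattice M G \<phi>) \<and>
     (\<forall>H \<in> filter_lattice M G \<phi>. \<forall>K \<in> filter_lattice M G \<phi>.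
        (H \<inter> K) \<inter> Y = (H \<inter> Y) \<inter> (K \<inter> Y)) \<and>
     (\<forall>H \<in> filter_lattice M G \<phi>. \<forall>K \<in> filter_lattice M G \<phi>.
        (H <#>\<^bsub>G\<^esub> K) \<inter> Y = (H \<inter> Y) \<union> (K \<inter> Y)) \<and>
     (\<forall>x \<in> Y. \<exists>!s. s \<in> carrier M \<and> x \<in> \<phi> s - filter_boundary M G \<phi> s))"

end

theory Submission
  imports Defs
begin

text \<open>
  Let \<open>S\<close> be the set of those \<open>s \<noteq> 0\<close> for which the section \<open>\<phi>\<^sub>s / \<partial>\<phi>\<^sub>s\<close> is nontrivial. The proof
  cuts \<open>G\<close> into exactly these sections. The direct sum and the group are then assembled from the
  same pieces, and choosing a representative in each coset turns an element of the direct sum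
  into a product of representatives in \<open>G\<close>.

  The cutting rests on the set \<open>Y\<close> that witnesses faithfulness. Each \<open>x \<in> Y\<close> has a degree: the only
  \<open>s\<close> with \<open>x \<in> \<phi>\<^sub>s\<close> and \<open>x \<notin> \<partial>\<phi>\<^sub>s\<close>. The key fact is that every member of the lattice of \<open>\<phi>\<close> that
  contains \<open>x\<close> contains the whole of \<open>\<phi>\<close> at the degree of \<open>x\<close> (\<open>degree_subset_lattice\<close>). To see this
  for \<open>\<phi>\<^sub>t\<close>, descend: if \<open>x\<close> lies in \<open>\<partial>\<phi>\<^sub>t\<close>, which is a join of values of \<open>\<phi>\<close>, then \<open>x\<close> lies in one of
  these values, because \<open>Y\<close> turns joins into unions. Inertia-freeness makes the descent stop.
  Consequently \<open>\<phi>\<close> is injective on \<open>S\<close>, so \<open>S\<close> is finite. List \<open>S\<close> so that no \<open>\<phi>\<^sub>s\<close> is contained in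
  a later \<open>\<phi>\<^sub>t\<close>, and let \<open>H\<^sub>s\<close> be the product of all \<open>\<phi>\<^sub>t\<close> with \<open>t\<close> later than \<open>s\<close>. Comparing traces on
  \<open>Y\<close> gives \<open>\<phi>\<^sub>s \<inter> H\<^sub>s = \<partial>\<phi>\<^sub>s\<close> (\<open>support_layer_meet\<close>), and the product of all \<open>\<phi>\<^sub>s\<close> is \<open>G\<close>
  (\<open>layer_product_support\<close>). Hence \<open>\<phi>\<^sub>s H\<^sub>s / H\<^sub>s\<close> is isomorphic to \<open>\<phi>\<^sub>s / \<partial>\<phi>\<^sub>s\<close>, and the products \<open>H\<^sub>s\<close>
  form a normal series of \<open>G\<close> with these factors.

  Each section is abelian, since \<open>[\<phi>\<^sub>s, \<phi>\<^sub>s] \<subseteq> \<phi>\<^sub>s\<^sub>+\<^sub>s \<subseteq> \<partial>\<phi>\<^sub>s\<close> for \<open>s \<noteq> 0\<close>, and finitely generated, since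
  all subgroups of a finitely generated nilpotent group are (\<open>noetherian_of_fg_nilpotent\<close>). Choose
  finitely many generating cosets in every section and concatenate them along the list. In the
  direct sum, which is abelian, every finite generating list is a polycyclic generating sequence.
  In \<open>G\<close> the chosen representatives, in the same order, refine the series: modulo \<open>H\<^sub>s\<close> the
  elements of \<open>\<phi>\<^sub>s\<close> commute, so each subgroup generated by a tail of the list is normal in the
  next (\<open>bijection_of_pcgs\<close>).
\<close>

section \<open>Commutators modulo a normal subgroup\<close>

lemma generate_superset: "S \<subseteq> generate G S"
  by (auto intro: generate.incl)

lemma (in normal) group_hom_Mod: "group_hom G (G Mod H) (\<lambda>x. H #> x)"
  by (simp add: group_hom_def group_hom_axioms_def is_group factorgroup_is_group r_coset_hom_Mod)

lemma (in normal) r_coset_eq_iff: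
  assumes "x \<in> carrier G" "y \<in> carrier G"
  shows "H #> x = H #> y \<longleftrightarrow> x \<otimes> inv y \<in> H"
  by (metis assms is_group rcos_const rcos_module rcos_self repr_independence
      subgroup_axioms group.rcos_self group.repr_independence)

lemma (in normal) commutator_mem_iff:
  assumes "x \<in> carrier G" "y \<in> carrier G"
  shows "x \<otimes> y \<otimes> inv x \<otimes> inv y \<in> H \<longleftrightarrow> H #> (x \<otimes> y) = H #> (y \<otimes> x)"
  using assms by (simp add: r_coset_eq_iff inv_mult_group m_assoc)

text \<open>Dividing out all but one of the generators leaves a cyclic group.\<close>

lemma (in normal) image_generate_insert:
  assumes a: "a \<in> carrier G" and S: "S \<subseteq> H"
  shows "(\<lambda>x. H #> x) ` generate G (insert a S) = {(H #> a) [^]\<^bsub>G Mod H\<^esub> (k::int) | k. k \<in> UNIV}"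
proof -
  interpret \<pi>: group_hom G "G Mod H" "\<lambda>x. H #> x" by (rule group_hom_Mod)
  have sub: "insert a S \<subseteq> carrier G" using a S subset by auto
  have a': "{H #> a} \<subseteq> carrier (G Mod H)" using a by auto
  have "(\<lambda>x. H #> x) ` generate G (insert a S) = generate (G Mod H) ((\<lambda>x. H #> x) ` insert a S)"
    using \<pi>.generate_img[OF sub] by simp
  also have "\<dots> = generate (G Mod H) {H #> a}"
  proof
    show "generate (G Mod H) {H #> a} \<subseteq> generate (G Mod H) ((\<lambda>x. H #> x) ` insert a S)"
      by (intro \<pi>.H.mono_generate) auto
    have "H #> h = \<one>\<^bsub>G Mod H\<^esub>" if "h \<in> S" for h
      using that S rcos_const is_group by auto
    then show "generate (G Mod H) ((\<lambda>x. H #> x) ` insert a S) \<subseteq> generate (G Mod H) {H #> a}"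
      using generate.incl[of "H #> a" "{H #> a}" "G Mod H"] generate.one[of "G Mod H" "{H #> a}"]
      by (intro \<pi>.H.generate_subgroup_incl \<pi>.H.generate_is_subgroup a') auto
  qed
  also have "\<dots> = {(H #> a) [^]\<^bsub>G Mod H\<^esub> (k::int) | k. k \<in> UNIV}"
    using a by (intro \<pi>.H.generate_pow) auto
  finally show ?thesis .
qed

text \<open>Pairwise commuting generators generate commuting subgroups; the second argument is extended
  first, with the first one fixed, and then the roles are exchanged.\<close>

lemma (in group) commute_generate_right:
  assumes "x \<in> carrier G" "T \<subseteq> carrier G" "\<And>t. t \<in> T \<Longrightarrow> x \<otimes> t = t \<otimes> x"
    and "y \<in> generate G T"
  shows "x \<otimes> y = y \<otimes> x"
  using assms(4)
proof induction
  case one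
  then show ?case using assms by simp
next
  case (incl h)
  then show ?case using assms by simp
next
  case (inv h)
  then have "h \<in> carrier G" "x \<otimes> h = h \<otimes> x" using assms by auto
  then show ?case
    by (metis assms(1) inv_closed inv_solve_left inv_solve_right m_assoc m_closed)
next
  case (eng h1 h2)
  then have "h1 \<in> carrier G" "h2 \<in> carrier G"
    using assms(2) generate_in_carrier by blast+
  then show ?case
    using eng.IH assms(1) by (metis m_assoc)
qed

lemma (in group) commute_generate:
  assumes "S \<subseteq> carrier G" "T \<subseteq> carrier G"
    and "\<And>s t. s \<in> S \<Longrightarrow> t \<in> T \<Longrightarrow> s \<otimes> t = t \<otimes> s"
    and "x \<in> generate G S" "y \<in> generate G T"
  shows "x \<otimes> y = y \<otimes> x"
proof -
  have "s \<otimes> y = y \<otimes> s" if "s \<in> S" for s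
    using commute_generate_right[of s T y] assms that by blast
  then show ?thesis
    using commute_generate_right[of y S x] assms generate_in_carrier by (metis (no_types, lifting))
qed

text \<open>Commuting modulo \<open>N\<close> is commuting of images in \<open>G Mod N\<close>, and there it passes from
  generators to the subgroups they generate.\<close>

lemma (in group) commutator_generate_mem:
  assumes N: "N \<lhd> G" and S: "S \<subseteq> carrier G" and T: "T \<subseteq> carrier G"
    and comm: "\<And>s t. s \<in> S \<Longrightarrow> t \<in> T \<Longrightarrow> s \<otimes> t \<otimes> inv s \<otimes> inv t \<in> N"
    and x: "x \<in> generate G S" and y: "y \<in> generate G T"
  shows "x \<otimes> y \<otimes> inv x \<otimes> inv y \<in> N"
proof -
  interpret N: normal N G by (rule N)
  interpret \<pi>: group_hom G "G Mod N" "\<lambda>x. N #> x" by (rule N.group_hom_Mod)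
  have xy: "x \<in> carrier G" "y \<in> carrier G"
    using x y S T generate_in_carrier by auto
  have "(N #> s) \<otimes>\<^bsub>G Mod N\<^esub> (N #> t) = (N #> t) \<otimes>\<^bsub>G Mod N\<^esub> (N #> s)"
    if "s \<in> S" "t \<in> T" for s t
  proof -
    have st: "s \<in> carrier G" "t \<in> carrier G" using that S T by auto
    then have "N #> (s \<otimes> t) = N #> (t \<otimes> s)"
      using comm[OF that] N.commutator_mem_iff[of s t] by blast
    then show ?thesis
      using st by (simp only: mult_FactGroup N.rcos_sum)
  qed
  then have comm': "u \<otimes>\<^bsub>G Mod N\<^esub> v = v \<otimes>\<^bsub>G Mod N\<^esub> u"
    if "u \<in> (\<lambda>x. N #> x) ` S" "v \<in> (\<lambda>x. N #> x) ` T" for u v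
    using that by blast
  have "(N #> x) \<otimes>\<^bsub>G Mod N\<^esub> (N #> y) = (N #> y) \<otimes>\<^bsub>G Mod N\<^esub> (N #> x)"
  proof (rule \<pi>.H.commute_generate[OF _ _ comm'])
    show "(\<lambda>x. N #> x) ` S \<subseteq> carrier (G Mod N)" "(\<lambda>x. N #> x) ` T \<subseteq> carrier (G Mod N)"
      using S T by (auto simp: carrier_FactGroup)
    show "N #> x \<in> generate (G Mod N) ((\<lambda>x. N #> x) ` S)"
      using x \<pi>.generate_img[OF S] by blast
    show "N #> y \<in> generate (G Mod N) ((\<lambda>x. N #> x) ` T)"
      using y \<pi>.generate_img[OF T] by blast
  qed
  then have "N #> (x \<otimes> y) = N #> (y \<otimes> x)"
    using xy by (simp only: mult_FactGroup N.rcos_sum)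
  then show ?thesis
    using xy N.commutator_mem_iff by blast
qed

lemma (in group) commutator_swap_mem:
  assumes "subgroup N G" "x \<in> carrier G" "y \<in> carrier G"
    and "x \<otimes> y \<otimes> inv x \<otimes> inv y \<in> N"
  shows "y \<otimes> x \<otimes> inv y \<otimes> inv x \<in> N"
proof -
  have "inv (x \<otimes> y \<otimes> inv x \<otimes> inv y) = y \<otimes> x \<otimes> inv y \<otimes> inv x"
    using assms by (simp add: inv_mult_group m_assoc)
  then show ?thesis using subgroup.m_inv_closed[OF assms(1,4)] by simp
qed

text \<open>Since \<open>x k x\<inverse> = [x, k] k\<close>, closure of \<open>K\<close> under commutators with \<open>H\<close> is normality in \<open>H\<close>.\<close>

lemma (in group) normal_of_commutators:
  assumes K: "subgroup K G" and H: "subgroup H G" and KH: "K \<subseteq> H"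
    and comm: "\<And>x k. x \<in> H \<Longrightarrow> k \<in> K \<Longrightarrow> x \<otimes> k \<otimes> inv x \<otimes> inv k \<in> K"
  shows "K \<lhd> G\<lparr>carrier := H\<rparr>"
proof -
  interpret H: group "G\<lparr>carrier := H\<rparr>" using subgroup_imp_group[OF H] .
  have "x \<otimes> k \<otimes> inv x \<in> K" if "x \<in> H" "k \<in> K" for x k
  proof -
    have c: "x \<in> carrier G" "k \<in> carrier G"
      using that subgroup.mem_carrier[OF H] KH by auto
    have "x \<otimes> k \<otimes> inv x \<otimes> inv k \<otimes> k \<in> K"
      using comm[OF that] that(2) K subgroup.m_closed by metis
    then show ?thesis using c by (simp add: m_assoc)
  qed
  then show ?thesis
    unfolding H.normal_inv_iff
    using K H KH subgroup_incl m_inv_consistent[OF H] by simp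
qed

section \<open>Subgroups of finitely generated nilpotent groups\<close>

text \<open>Finite generation of all subgroups inside \<open>H\<close> is the property that passes up an extension;
  finite generation of \<open>H\<close> alone is not inherited by its subgroups.\<close>

definition noetherian_in :: "('a, 'b) monoid_scheme \<Rightarrow> 'a set \<Rightarrow> bool" where
  "noetherian_in G H \<longleftrightarrow>
     (\<forall>K. subgroup K G \<longrightarrow> K \<subseteq> H \<longrightarrow> (\<exists>F. finite F \<and> F \<subseteq> carrier G \<and> generate G F = K))"

text \<open>The least positive element of a subgroup of the integers generates it, by division with
  remainder; if there is none, the generator is zero.\<close>

lemma int_subgroup_principal:
  fixes D :: "int set"
  assumes "0 \<in> D" and diff: "\<And>m n. m \<in> D \<Longrightarrow> n \<in> D \<Longrightarrow> m - n \<in> D"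
  shows "\<exists>d \<in> D. \<forall>n \<in> D. d dvd n"
proof (cases "D = {0}")
  case True
  then show ?thesis by simp
next
  case False
  have neg: "- m \<in> D" if "m \<in> D" for m using diff[OF \<open>0 \<in> D\<close> that] by simp
  have mul: "d * int q \<in> D" if "d \<in> D" for d q
  proof (induction q)
    case (Suc q)
    then show ?case using diff[OF Suc neg[OF that]] by (simp add: algebra_simps)
  qed (use assms in simp)
  have mult: "d * q \<in> D" if "d \<in> D" for d q
    using mul[OF that, of "nat q"] neg[OF mul[OF that, of "nat (- q)"]]
    by (cases "q \<ge> 0") auto
  define P where "P n \<longleftrightarrow> 0 < n \<and> int n \<in> D" for n
  obtain m where "m \<in> D" "m \<noteq> 0" using False \<open>0 \<in> D\<close> by auto
  then have "P (nat \<bar>m\<bar>)" using neg unfolding P_def by (auto simp: abs_if)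
  then have least: "P (LEAST n. P n)" and min: "\<And>n. P n \<Longrightarrow> (LEAST n. P n) \<le> n"
    by (auto intro: LeastI Least_le)
  define d where "d = int (LEAST n. P n)"
  have d: "d \<in> D" "0 < d" using least unfolding P_def d_def by auto
  have "d dvd n" if "n \<in> D" for n
  proof -
    have "n mod d \<in> D"
      using diff[OF that mult[OF d(1), of "n div d"]] by (simp add: minus_mult_div_eq_mod)
    then have "d \<le> n mod d" if "0 < n mod d"
      using min[of "nat (n mod d)"] that unfolding P_def d_def by (simp add: le_nat_iff)
    then have "\<not> 0 < n mod d" using pos_mod_bound[OF d(2), of n] by linarith
    then show ?thesis
      using pos_mod_sign[OF d(2), of n] by (simp add: dvd_eq_mod_eq_0)
  qed
  then show ?thesis using d by blast
qed

text \<open>A subgroup \<open>K\<close> has a cyclic image modulo \<open>N\<close>: the exponents \<open>n\<close> for which \<open>a\<^sup>n\<close> is congruent to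
  an element of \<open>K\<close> form a subgroup of the integers. Lifting its generator to \<open>k \<in> K\<close>, every element
  of \<open>K\<close> is a power of \<open>k\<close> up to an element of \<open>N \<inter> K\<close>, which is finitely generated by assumption.\<close>

lemma (in group) noetherian_in_insert:
  assumes N: "N \<lhd> G" and noeth: "noetherian_in G N" and a: "a \<in> carrier G"
  shows "noetherian_in G (generate G (insert a N))"
  unfolding noetherian_in_def
proof (intro allI impI)
  fix K assume K: "subgroup K G" "K \<subseteq> generate G (insert a N)"
  interpret N: normal N G by (rule N)
  interpret \<pi>: group_hom G "G Mod N" "\<lambda>x. N #> x" by (rule N.group_hom_Mod)
  note Kc = subgroup.mem_carrier[OF K(1)]
  have power: "\<exists>n::int. N #> x = N #> a [^] n" if "x \<in> K" for x
  proof -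
    have "N #> x \<in> (\<lambda>x. N #> x) ` generate G (insert a N)" using that K(2) by auto
    then show ?thesis
      unfolding N.image_generate_insert[OF a subset_refl] using a by (auto simp: N.FactGroup_int_pow)
  qed
  define D where "D = {n::int. \<exists>x \<in> K. N #> x = N #> a [^] n}"
  have "\<exists>d \<in> D. \<forall>n \<in> D. d dvd n"
  proof (rule int_subgroup_principal)
    show "0 \<in> D" using subgroup.one_closed[OF K(1)] by (auto simp: D_def intro!: bexI[of _ "\<one>"])
    fix m n assume "m \<in> D" "n \<in> D"
    then obtain x y where xy: "x \<in> K" "N #> x = N #> a [^] m" "y \<in> K" "N #> y = N #> a [^] n"
      by (auto simp: D_def)
    have "N #> (x \<otimes> inv y) = (N #> x) \<otimes>\<^bsub>G Mod N\<^esub> inv\<^bsub>G Mod N\<^esub> (N #> y)"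
      using xy Kc \<pi>.hom_mult[of x "inv y"] \<pi>.hom_inv[of y] by (simp only: inv_closed)
    also have "\<dots> = N #> (a [^] m \<otimes> inv (a [^] n))"
      using xy a \<pi>.hom_mult[of "a [^] m" "inv (a [^] n)"] \<pi>.hom_inv[of "a [^] n"]
      by (simp only: inv_closed int_pow_closed)
    finally have "N #> (x \<otimes> inv y) = N #> a [^] (m - n)"
      using a by (simp only: int_pow_diff)
    then show "m - n \<in> D"
      using xy K(1) by (auto simp: D_def intro: subgroup.m_closed subgroup.m_inv_closed)
  qed
  then obtain d k where d: "\<forall>n \<in> D. d dvd n" and k: "k \<in> K" "N #> k = N #> a [^] d"
    by (auto simp: D_def)
  have "subgroup (N \<inter> K) G" using K(1) N.subgroup_axioms subgroup_Int by metis
  then obtain F where F: "finite F" "F \<subseteq> carrier G" "generate G F = N \<inter> K"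
    using noeth unfolding noetherian_in_def by (metis Int_lower1)
  have "generate G (insert k F) = K"
  proof
    show "generate G (insert k F) \<subseteq> K"
      using k F K(1) generate.incl[of _ F G] by (intro generate_subgroup_incl) auto
    show "K \<subseteq> generate G (insert k F)"
    proof
      fix x assume x: "x \<in> K"
      then obtain n :: int where n: "N #> x = N #> a [^] n" using power by blast
      with x have "n \<in> D" by (auto simp: D_def)
      then obtain q where q: "n = d * q" using d by (auto simp: dvd_def)
      have "N #> k [^] q = (N #> a [^] d) [^]\<^bsub>G Mod N\<^esub> q"
        using k Kc by (simp flip: N.FactGroup_int_pow)
      also have "\<dots> = N #> x" using a n q by (simp add: N.FactGroup_int_pow int_pow_pow)
      finally have "x \<otimes> inv (k [^] q) \<in> N"
        using N.r_coset_eq_iff[of x "k [^] q"] x k Kc by simp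
      moreover have kq: "k [^] q \<in> K" using k K(1) subgroup_int_pow_closed by simp
      ultimately have "x \<otimes> inv (k [^] q) \<in> generate G F"
        using F(3) x K(1) subgroup.m_closed subgroup.m_inv_closed by fastforce
      then have 1: "x \<otimes> inv (k [^] q) \<in> generate G (insert k F)"
        using mono_generate[of F "insert k F"] by auto
      have sub: "subgroup (generate G (insert k F)) G"
        using k Kc F by (intro generate_is_subgroup) auto
      have "k [^] q \<in> generate G (insert k F)"
        using subgroup_int_pow_closed[OF sub generate.incl] by simp
      then have "x \<otimes> inv (k [^] q) \<otimes> k [^] q \<in> generate G (insert k F)"
        using 1 sub subgroup.m_closed by metis
      then show "x \<in> generate G (insert k F)" using x kq Kc by (simp add: m_assoc)
    qed
  qed
  then show "\<exists>F. finite F \<and> F \<subseteq> carrier G \<and> generate G F = K"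
    using F k Kc by (intro exI[of _ "insert k F"]) auto
qed


text \<open>Adjoin the generators one at a time. Centrality of \<open>H / N\<close> keeps all the intermediate subgroups
  normal in the whole group, so that the cyclic step applies again.\<close>

lemma (in group) noetherian_in_central_extension:
  assumes N: "N \<lhd> G" "N \<subseteq> H" and noeth: "noetherian_in G N" and H: "subgroup H G"
    and central: "\<And>x g. x \<in> H \<Longrightarrow> g \<in> carrier G \<Longrightarrow> x \<otimes> g \<otimes> inv x \<otimes> inv g \<in> N"
    and F: "finite F" "F \<subseteq> H"
  shows "noetherian_in G (generate G (F \<union> N))"
  using F
proof (induction F)
  case empty
  then show ?case
    using noeth N(1) generateI[of N N] normal_imp_subgroup by fastforce
next
  case (insert a F)
  note Hc = subgroup.subset[OF H]
  define K where "K = generate G (F \<union> N)"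
  have sub: "F \<union> N \<subseteq> carrier G" using insert.prems N Hc by auto
  have K: "subgroup K G" unfolding K_def using sub by (rule generate_is_subgroup)
  have NK: "N \<subseteq> K" and FK: "F \<subseteq> K" unfolding K_def by (auto intro: generate.incl)
  have KH: "K \<subseteq> H" unfolding K_def using insert.prems N H by (intro generate_subgroup_incl) auto
  have "K \<lhd> G\<lparr>carrier := carrier G\<rparr>"
  proof (rule normal_of_commutators[OF K subgroup_self])
    fix x k assume "x \<in> carrier G" "k \<in> K"
    then show "x \<otimes> k \<otimes> inv x \<otimes> inv k \<in> K"
      using central[of k x] KH NK Hc commutator_swap_mem[of N k x] normal_imp_subgroup[OF N(1)]
      by (meson subsetD)
  qed (use KH Hc in auto)
  then have "K \<lhd> G" by simp
  then have "noetherian_in G (generate G (insert a K))"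
    using noetherian_in_insert insert Hc unfolding K_def by blast
  moreover have "generate G (insert a F \<union> N) \<subseteq> generate G (insert a K)"
    using NK FK by (intro mono_generate) auto
  ultimately show ?case
    unfolding noetherian_in_def by (meson subset_trans)
qed

lemma (in group) commutator_subgroup_normal:
  assumes "H \<lhd> G"
  shows "commutator_subgroup G H (carrier G) \<lhd> G" "commutator_subgroup G H (carrier G) \<subseteq> H"
proof -
  interpret H: normal H G by (rule assms)
  show "commutator_subgroup G H (carrier G) \<lhd> G"
    unfolding commutator_subgroup_def
  proof (rule normal_generateI, force)
    fix c g assume "c \<in> {h \<otimes> k \<otimes> inv h \<otimes> inv k |h k. h \<in> H \<and> k \<in> carrier G}" and g: "g \<in> carrier G"
    then obtain h k where hk: "h \<in> H" "k \<in> carrier G" "c = h \<otimes> k \<otimes> inv h \<otimes> inv k" by auto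
    have cancel: "inv g \<otimes> (g \<otimes> z) = z" if "z \<in> carrier G" for z
      using that g by (simp flip: m_assoc)
    \<comment> \<open>A conjugate of a commutator is the commutator of the conjugates.\<close>
    have "g \<otimes> c \<otimes> inv g = (g \<otimes> h \<otimes> inv g) \<otimes> (g \<otimes> k \<otimes> inv g)
            \<otimes> inv (g \<otimes> h \<otimes> inv g) \<otimes> inv (g \<otimes> k \<otimes> inv g)"
      using g hk by (simp add: inv_mult_group m_assoc cancel)
    moreover have "g \<otimes> h \<otimes> inv g \<in> H" "g \<otimes> k \<otimes> inv g \<in> carrier G"
      using g hk H.inv_op_closed2 by auto
    ultimately show "g \<otimes> c \<otimes> inv g \<in> {h \<otimes> k \<otimes> inv h \<otimes> inv k |h k. h \<in> H \<and> k \<in> carrier G}"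
      by blast
  qed
  have "h \<otimes> k \<otimes> inv h \<otimes> inv k \<in> H" if "h \<in> H" "k \<in> carrier G" for h k
    using that H.m_closed[OF that(1) H.inv_op_closed2[OF that(2) H.m_inv_closed[OF that(1)]]]
    by (simp add: m_assoc)
  then show "commutator_subgroup G H (carrier G) \<subseteq> H"
    unfolding commutator_subgroup_def by (intro generate_subgroup_incl H.subgroup_axioms) auto
qed

lemma (in group) lower_central_series_normal: "lower_central_series G n \<lhd> G"
  by (induction n) (auto simp: normal_self commutator_subgroup_normal)

lemma (in group) lower_central_series_Suc_subset:
  "lower_central_series G (Suc n) \<subseteq> lower_central_series G n"
  using commutator_subgroup_normal(2)[OF lower_central_series_normal] by simp

lemma (in group) commutator_mem_lower_central_series:
  assumes "x \<in> lower_central_series G n" "g \<in> carrier G"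
  shows "x \<otimes> g \<otimes> inv x \<otimes> inv g \<in> lower_central_series G (Suc n)"
  using assms by (auto simp: commutator_subgroup_def intro!: generate.incl)

text \<open>Modulo the next term, a term of the lower central series is generated by the commutators
  of generators of the previous term with generators of the group, since the commutator is
  bilinear modulo the next term.\<close>

lemma (in group) lower_central_series_fg:
  assumes T: "finite T" "T \<subseteq> carrier G" "generate G T = carrier G"
  shows "\<exists>F. finite F \<and> F \<subseteq> lower_central_series G n \<and>
             lower_central_series G n \<subseteq> generate G (F \<union> lower_central_series G (Suc n))"
proof (induction n)
  case 0
  have "generate G T \<subseteq> generate G (T \<union> lower_central_series G (Suc 0))"
    by (rule mono_generate) auto
  then show ?case using T by (intro exI[of _ T]) (simp del: lower_central_series.simps(2))
next
  case (Suc n)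
  let ?\<gamma> = "lower_central_series G"
  note subsets = normal_imp_subgroup[OF lower_central_series_normal, THEN subgroup.subset]
  from Suc obtain F where F: "finite F" "F \<subseteq> ?\<gamma> n" "?\<gamma> n \<subseteq> generate G (F \<union> ?\<gamma> (Suc n))" by blast
  define E where "E = (\<lambda>(f, t). f \<otimes> t \<otimes> inv f \<otimes> inv t) ` (F \<times> T)"
  have "f \<otimes> t \<otimes> inv f \<otimes> inv t \<in> ?\<gamma> (Suc n)" if "f \<in> F" "t \<in> T" for f t
    using commutator_mem_lower_central_series[of f n t] that F(2) T(2) by blast
  then have E: "finite E" "E \<subseteq> ?\<gamma> (Suc n)"
    using F(1) T(1) unfolding E_def by auto
  define K where "K = generate G (E \<union> ?\<gamma> (Suc (Suc n)))"
  have Ksub: "K \<subseteq> ?\<gamma> (Suc n)"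
    unfolding K_def using E lower_central_series_Suc_subset[of "Suc n"]
    by (intro generate_subgroup_incl normal_imp_subgroup lower_central_series_normal) auto
  have sub: "E \<union> ?\<gamma> (Suc (Suc n)) \<subseteq> carrier G" using E subsets by blast
  have \<gamma>K: "?\<gamma> (Suc (Suc n)) \<subseteq> K" and EK: "E \<subseteq> K"
    unfolding K_def by (auto intro: generate.incl simp del: lower_central_series.simps)
  have subK: "subgroup K G" unfolding K_def using sub by (rule generate_is_subgroup)
  have "K \<lhd> G\<lparr>carrier := carrier G\<rparr>"
  proof (rule normal_of_commutators[OF subK subgroup_self])
    fix x k assume x: "x \<in> carrier G" and k: "k \<in> K"
    then have "k \<otimes> x \<otimes> inv k \<otimes> inv x \<in> K"
      using commutator_mem_lower_central_series[of k "Suc n" x] Ksub \<gamma>K by blast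
    then show "x \<otimes> k \<otimes> inv x \<otimes> inv k \<in> K"
      using commutator_swap_mem[OF subK] x k subgroup.mem_carrier[OF subK] by blast
  qed (use subgroup.subset[OF subK] in auto)
  then have K: "K \<lhd> G" by simp
  have "h \<otimes> g \<otimes> inv h \<otimes> inv g \<in> K" if "h \<in> ?\<gamma> n" "g \<in> carrier G" for h g
  proof (rule commutator_generate_mem[OF K, of "F \<union> ?\<gamma> (Suc n)" T])
    show "F \<union> ?\<gamma> (Suc n) \<subseteq> carrier G" using F subsets by blast
    fix s t assume "s \<in> F \<union> ?\<gamma> (Suc n)" "t \<in> T"
    then show "s \<otimes> t \<otimes> inv s \<otimes> inv t \<in> K"
      using EK \<gamma>K commutator_mem_lower_central_series[of s "Suc n" t] T(2) unfolding E_def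
      by (auto simp del: lower_central_series.simps)
  qed (use F T that in auto)
  then have "{h \<otimes> g \<otimes> inv h \<otimes> inv g |h g. h \<in> ?\<gamma> n \<and> g \<in> carrier G} \<subseteq> K"
    by blast
  then have "?\<gamma> (Suc n) \<subseteq> K"
    using generate_subgroup_incl[OF _ subK] by (simp add: commutator_subgroup_def)
  then show ?case using E unfolding K_def by blast
qed

text \<open>Climb the lower central series from its trivial term: each step up is a central extension by
  finitely many elements.\<close>

theorem (in group) noetherian_of_fg_nilpotent:
  assumes "fg_group G" "nilpotent_group G"
  shows "noetherian_in G (carrier G)"
proof -
  obtain T where T: "finite T" "T \<subseteq> carrier G" "generate G T = carrier G"
    using assms(1) unfolding fg_group_def by blast
  obtain n where n: "lower_central_series G n = {\<one>}"
    using assms(2) unfolding nilpotent_group_def by blast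
  have "noetherian_in G (lower_central_series G 0)"
    using le0[of n]
  proof (induction rule: inc_induct)
    case base
    have "K = {\<one>}" if "subgroup K G" "K \<subseteq> {\<one>}" for K
      using that subgroup.one_closed by blast
    then show ?case
      unfolding noetherian_in_def n by (metis empty_subsetI finite.emptyI generate_empty)
  next
    case (step m)
    let ?\<gamma> = "lower_central_series G"
    obtain F where F: "finite F" "F \<subseteq> ?\<gamma> m" "?\<gamma> m \<subseteq> generate G (F \<union> ?\<gamma> (Suc m))"
      using lower_central_series_fg[OF T] by blast
    have "noetherian_in G (generate G (F \<union> ?\<gamma> (Suc m)))"
      using step F commutator_mem_lower_central_series
      by (intro noetherian_in_central_extension[of _ "?\<gamma> m"] lower_central_series_normal
          lower_central_series_Suc_subset normal_imp_subgroup) auto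
    then show ?case
      using F(3) unfolding noetherian_in_def by (meson subset_trans)
  qed
  then show ?thesis by simp
qed

section \<open>Polycyclic generating sequences from chains of normal subgroups\<close>

text \<open>The normality part of the notion of a polycyclic generating sequence, by recursion on the list.
  Cyclicity of the quotients comes for free, as each differs from the next by one generator.\<close>

primrec subnormal_list :: "('a, 'b) monoid_scheme \<Rightarrow> 'a list \<Rightarrow> bool" where
  "subnormal_list G [] \<longleftrightarrow> True"
| "subnormal_list G (a # as) \<longleftrightarrow>
     generate G (set as) \<lhd> G\<lparr>carrier := generate G (set (a # as))\<rparr> \<and> subnormal_list G as"

lemma (in group) cyclic_quotient_insert:
  assumes S: "insert a S \<subseteq> carrier G"
    and normal: "generate G S \<lhd> G\<lparr>carrier := generate G (insert a S)\<rparr>"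
  shows "cyclic_group (G\<lparr>carrier := generate G (insert a S)\<rparr> Mod generate G S)"
proof -
  let ?H = "generate G (insert a S)"
  interpret N: normal "generate G S" "G\<lparr>carrier := ?H\<rparr>" by (rule normal)
  interpret Q: group "G\<lparr>carrier := ?H\<rparr> Mod generate G S" by (rule N.factorgroup_is_group)
  have H: "subgroup ?H G" using S by (rule generate_is_subgroup)
  have sub: "insert a S \<subseteq> ?H" by (auto intro: generate.incl)
  then have a: "a \<in> carrier (G\<lparr>carrier := ?H\<rparr>)" by simp
  have "generate (G\<lparr>carrier := ?H\<rparr>) (insert a S) = ?H"
    using generate_consistent[OF sub H] by simp
  then have "carrier (G\<lparr>carrier := ?H\<rparr> Mod generate G S) =
      range (\<lambda>n::int. (generate G S #>\<^bsub>G\<lparr>carrier := ?H\<rparr>\<^esub> a) [^]\<^bsub>G\<lparr>carrier := ?H\<rparr> Mod generate G S\<^esub> n)"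
    using N.image_generate_insert[OF a, of S] generate.incl[of _ S G]
    by (simp add: carrier_FactGroup full_SetCompr_eq subsetI)
  moreover have "generate G S #>\<^bsub>G\<lparr>carrier := ?H\<rparr>\<^esub> a \<in> carrier (G\<lparr>carrier := ?H\<rparr> Mod generate G S)"
    using a by (simp only: carrier_FactGroup) blast
  ultimately show ?thesis using Q.cyclic_group by blast
qed

lemma (in group) pcgs_of_subnormal_list:
  assumes "set as \<subseteq> carrier G" "generate G (set as) = carrier G" "subnormal_list G as"
  shows "pcgs G as"
proof -
  have "generate G (set (drop (Suc i) as)) \<lhd> G\<lparr>carrier := generate G (set (drop i as))\<rparr>"
    if "subnormal_list G as" "i < length as" for as :: "'a list" and i
    using that
  proof (induction as arbitrary: i)
    case (Cons a as)
    then show ?case by (cases i) auto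
  qed simp
  moreover have "set (drop i as) = insert (as ! i) (set (drop (Suc i) as))" if "i < length as" for i
    using Cons_nth_drop_Suc[OF that] by (metis list.simps(15))
  moreover have "set (drop i as) \<subseteq> carrier G" for i
    using assms(1) set_drop_subset by fastforce
  ultimately show ?thesis
    unfolding pcgs_def using assms cyclic_quotient_insert by metis
qed

lemma (in comm_group) pcgs_of_generating_list:
  assumes "set as \<subseteq> carrier G" "generate G (set as) = carrier G"
  shows "pcgs G as"
proof (rule pcgs_of_subnormal_list[OF assms])
  show "subnormal_list G as"
    using assms(1)
  proof (induction as)
    case (Cons a as)
    have sub: "subgroup (generate G (set as)) G" "subgroup (generate G (set (a # as))) G"
      using Cons.prems by (auto intro!: generate_is_subgroup)
    have "generate G (set as) \<lhd> G" using sub(1) by (rule subgroup_imp_normal)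
    moreover have "generate G (set as) \<subseteq> generate G (set (a # as))" by (rule mono_generate) auto
    ultimately show ?case using Cons normal_restrict_supergroup[OF sub(2)] by simp
  qed simp
qed

text \<open>Any two elements of the subgroup generated by \<open>A\<close> and \<open>as\<close> commute modulo the subgroup
  generated by \<open>as\<close>, which is normal. As this subgroup lies in every intermediate one, each of those is normal in
  the next.\<close>

lemma (in group) subnormal_list_append:
  assumes "subnormal_list G as" and as: "set as \<subseteq> carrier G" and N: "generate G (set as) \<lhd> G"
    and A: "A \<subseteq> carrier G" and l: "set l \<subseteq> A"
    and comm: "\<And>x y. x \<in> A \<Longrightarrow> y \<in> A \<Longrightarrow> x \<otimes> y \<otimes> inv x \<otimes> inv y \<in> generate G (set as)"
  shows "subnormal_list G (l @ as)"
  using l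
proof (induction l)
  case (Cons a l)
  let ?N = "generate G (set as)"
  interpret N: normal ?N G by (rule N)
  have c: "set (a # l @ as) \<subseteq> carrier G" "set (l @ as) \<subseteq> carrier G" using Cons.prems A as by auto
  have pair: "s \<otimes> t \<otimes> inv s \<otimes> inv t \<in> ?N" if mem: "s \<in> A \<union> set as" "t \<in> A \<union> set as" for s t
  proof -
    have st: "s \<in> carrier G" "t \<in> carrier G" using that A as by auto
    consider "s \<in> A" "t \<in> A" | "s \<in> ?N" | "t \<in> ?N" using mem generate.incl[of _ "set as" G] by blast
    then show ?thesis
    proof cases
      case 2
      then show ?thesis
        using st N.m_closed[OF 2 N.inv_op_closed2[OF st(2) N.m_inv_closed[OF 2]]] by (simp add: m_assoc)
    next
      case 3
      then show ?thesis
        using st N.m_closed[OF N.inv_op_closed2[OF st(1) 3] N.m_inv_closed[OF 3]] by (simp add: m_assoc)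
    qed (rule comm)
  qed
  have "generate G (set (l @ as)) \<lhd> G\<lparr>carrier := generate G (set (a # l @ as))\<rparr>"
  proof (rule normal_of_commutators)
    show "generate G (set (l @ as)) \<subseteq> generate G (set (a # l @ as))" by (rule mono_generate) auto
    fix x k assume "x \<in> generate G (set (a # l @ as))" "k \<in> generate G (set (l @ as))"
    moreover have "set (a # l @ as) \<subseteq> A \<union> set as" "set (l @ as) \<subseteq> A \<union> set as"
      using Cons.prems by auto
    ultimately have "x \<in> generate G (A \<union> set as)" "k \<in> generate G (A \<union> set as)"
      using mono_generate by blast+
    then have "x \<otimes> k \<otimes> inv x \<otimes> inv k \<in> ?N"
      using A as by (intro commutator_generate_mem[OF N _ _ pair]) auto
    then show "x \<otimes> k \<otimes> inv x \<otimes> inv k \<in> generate G (set (l @ as))"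
      using mono_generate[of "set as" "set (l @ as)"] by auto
  qed (use c in \<open>auto intro!: generate_is_subgroup dest: generate_in_carrier[rotated]\<close>)
  then show ?case using Cons by simp
qed (use assms in simp)

section \<open>Groups layered by abelian sections\<close>

text \<open>The groups \<open>A s\<close> are multiplied up starting from the end of the list, so that the tails of the
  list give an ascending chain of subgroups.\<close>

primrec layer_product :: "('a, 'b) monoid_scheme \<Rightarrow> ('i \<Rightarrow> 'a set) \<Rightarrow> 'i list \<Rightarrow> 'a set" where
  "layer_product G A [] = {\<one>\<^bsub>G\<^esub>}"
| "layer_product G A (s # ss) = A s <#>\<^bsub>G\<^esub> layer_product G A ss"

text \<open>The family \<open>x\<close> selects a coset for every index; the product of the chosen representatives is taken
  in the order in which \<open>layer_product\<close> multiplies the layers.\<close>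

primrec coset_product ::
    "('a, 'b) monoid_scheme \<Rightarrow> ('i \<Rightarrow> 'a set \<Rightarrow> 'a) \<Rightarrow> 'i list \<Rightarrow> ('i \<Rightarrow> 'a set) \<Rightarrow> 'a" where
  "coset_product G rep [] x = \<one>\<^bsub>G\<^esub>"
| "coset_product G rep (s # ss) x = rep s (x s) \<otimes>\<^bsub>G\<^esub> coset_product G rep ss x"

lemma coset_product_cong:
  assumes "\<forall>s \<in> set ss. x s = y s"
  shows "coset_product G rep ss x = coset_product G rep ss y"
  using assms by (induction ss) auto

lemma (in group) set_mult_supset:
  assumes "subgroup A G" "subgroup B G"
  shows "A \<subseteq> A <#> B" "B \<subseteq> A <#> B"
proof -
  have "a \<otimes> \<one> \<in> A <#> B" "\<one> \<otimes> b \<in> A <#> B" if "a \<in> A" "b \<in> B" for a b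
    using that assms subgroup.one_closed unfolding set_mult_def by blast+
  then show "A \<subseteq> A <#> B" "B \<subseteq> A <#> B"
    using assms subgroup.mem_carrier subgroup.one_closed by (metis subsetI r_one l_one)+
qed

text \<open>The second isomorphism theorem turns \<open>layer_meet\<close> into the statement that the successive factors
  of the chain of layer products are the sections \<open>A s / B s\<close>.\<close>

locale layered_group = group G for G (structure) +
  fixes A B :: "'i \<Rightarrow> 'a set" and ss :: "'i list"
  assumes distinct: "distinct ss"
    and A_normal: "s \<in> set ss \<Longrightarrow> A s \<lhd> G"
    and B_normal: "s \<in> set ss \<Longrightarrow> B s \<lhd> G"
    and layer_meet: "ss = us @ s # vs \<Longrightarrow> A s \<inter> layer_product G A vs = B s"
    and layer_abelian: "s \<in> set ss \<Longrightarrow> x \<in> A s \<Longrightarrow> y \<in> A s \<Longrightarrow> x \<otimes> y \<otimes> inv x \<otimes> inv y \<in> B s"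
begin

abbreviation section_group :: "'i \<Rightarrow> 'a set monoid" where
  "section_group s \<equiv> G\<lparr>carrier := A s\<rparr> Mod B s"

lemma B_subset_A: "s \<in> set ss \<Longrightarrow> B s \<subseteq> A s"
  using layer_meet split_list by fast

lemma B_normal_A:
  assumes "s \<in> set ss" shows "B s \<lhd> G\<lparr>carrier := A s\<rparr>"
  using normal_restrict_supergroup[OF normal_imp_subgroup[OF A_normal[OF assms]] B_normal[OF assms]
      B_subset_A[OF assms]] .

lemma carrier_section: "carrier (section_group s) = (\<lambda>x. B s #> x) ` A s"
  by (simp add: carrier_FactGroup)

lemma comm_group_section:
  assumes s: "s \<in> set ss" shows "comm_group (section_group s)"
proof -
  interpret B: normal "B s" G by (rule B_normal[OF s])
  interpret Q: group "section_group s" by (rule normal.factorgroup_is_group[OF B_normal_A[OF s]])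
  show ?thesis
  proof (rule Q.group_comm_groupI)
    fix U V assume "U \<in> carrier (section_group s)" "V \<in> carrier (section_group s)"
    then obtain x y where xy: "x \<in> A s" "U = B s #> x" "y \<in> A s" "V = B s #> y"
      unfolding carrier_section by blast
    then have c: "x \<in> carrier G" "y \<in> carrier G"
      using subgroup.subset[OF normal_imp_subgroup[OF A_normal[OF s]]] by auto
    have "B s #> (x \<otimes> y) = B s #> (y \<otimes> x)"
      using B.commutator_mem_iff[OF c] layer_abelian[OF s xy(1,3)] by blast
    then show "U \<otimes>\<^bsub>section_group s\<^esub> V = V \<otimes>\<^bsub>section_group s\<^esub> U"
      using c xy by (simp only: mult_FactGroup set_mult_consistent B.rcos_sum)
  qed
qed

lemma layer_product_normal: "ss = us @ vs \<Longrightarrow> layer_product G A vs \<lhd> G"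
proof (induction vs arbitrary: us)
  case (Cons s vs)
  then show ?case
    using Cons.IH[of "us @ [s]"] A_normal[of s] normal_subgroup_set_mult_closed by simp
qed (simp add: one_is_normal)

lemma B_subset_layer_product: "ss = us @ s # vs \<Longrightarrow> B s \<subseteq> layer_product G A vs"
  using layer_meet by blast

end

text \<open>One set can be a coset in the sections of two different indices, so a representative is chosen for
  an index together with a coset.\<close>

locale layered_group_with_representatives = layered_group G A B ss
  for G (structure) and A B :: "'i \<Rightarrow> 'a set" and ss :: "'i list" +
  fixes rep :: "'i \<Rightarrow> 'a set \<Rightarrow> 'a"
  assumes rep_mem: "s \<in> set ss \<Longrightarrow> C \<in> carrier (G\<lparr>carrier := A s\<rparr> Mod B s) \<Longrightarrow> rep s C \<in> C"
begin

lemma rep_in_A: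
  assumes "s \<in> set ss" "C \<in> carrier (section_group s)"
  shows "rep s C \<in> A s" "B s #> rep s C = C"
proof -
  interpret B: normal "B s" G by (rule B_normal[OF assms(1)])
  interpret A: normal "A s" G by (rule A_normal[OF assms(1)])
  obtain a where a: "a \<in> A s" "C = B s #> a" using assms(2) unfolding carrier_section by blast
  then obtain b where b: "b \<in> B s" "rep s C = b \<otimes> a"
    using rep_mem[OF assms] unfolding r_coset_def by blast
  then show "rep s C \<in> A s" using a B_subset_A[OF assms(1)] by auto
  show "B s #> rep s C = C"
    using repr_independence[OF rep_mem[OF assms, unfolded a(2)] _ B.subgroup_axioms] a by simp
qed

lemma coset_product_mem:
  assumes "ss = us @ vs" "\<And>s. s \<in> set vs \<Longrightarrow> x s \<in> carrier (section_group s)"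
  shows "coset_product G rep vs x \<in> layer_product G A vs"
  using assms
proof (induction vs arbitrary: us)
  case (Cons s vs)
  then have "rep s (x s) \<in> A s" by (intro rep_in_A) auto
  moreover have "coset_product G rep vs x \<in> layer_product G A vs"
    using Cons.IH[of "us @ [s]"] Cons.prems by simp
  ultimately show ?case by (auto simp: set_mult_def)
qed simp

text \<open>Split \<open>g = a h\<close> with \<open>a\<close> in the first layer and \<open>h\<close> in the product of the later ones. Replacing
  \<open>a\<close> by the representative of its coset changes it by an element of \<open>B s\<close>, which the later layers
  absorb.\<close>

lemma coset_product_surj:
  assumes "ss = us @ vs" "g \<in> layer_product G A vs"
  shows "\<exists>x. (\<forall>s \<in> set vs. x s \<in> carrier (section_group s)) \<and> coset_product G rep vs x = g"
  using assms
proof (induction vs arbitrary: us g)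
  case (Cons s vs)
  then have s: "s \<in> set ss" "s \<notin> set vs" using distinct by auto
  interpret A: normal "A s" G by (rule A_normal[OF s(1)])
  interpret B: normal "B s" G by (rule B_normal[OF s(1)])
  interpret H: normal "layer_product G A vs" G
    using layer_product_normal[of "us @ [s]" vs] Cons.prems by simp
  obtain a h where ah: "a \<in> A s" "h \<in> layer_product G A vs" "g = a \<otimes> h"
    using Cons.prems(2) by (auto simp: set_mult_def)
  define C where "C = B s #> a"
  have C: "C \<in> carrier (section_group s)" using ah unfolding C_def carrier_section by blast
  have r: "rep s C \<in> A s" "B s #> rep s C = B s #> a" using rep_in_A[OF s(1) C] C_def by auto
  then have "rep s C \<otimes> inv a \<in> B s" using ah B.r_coset_eq_iff by simp
  then have "inv (rep s C) \<otimes> (rep s C \<otimes> inv a) \<otimes> rep s C \<in> B s"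
    using r B.inv_op_closed1 by simp
  then have "inv a \<otimes> rep s C \<in> B s" using r ah by (simp flip: m_assoc)
  then have "inv (inv a \<otimes> rep s C) \<in> B s" by (rule B.m_inv_closed)
  then have "inv (rep s C) \<otimes> a \<in> layer_product G A vs"
    using r ah B_subset_layer_product[OF Cons.prems(1)] by (auto simp: inv_mult_group)
  then have "inv (rep s C) \<otimes> a \<otimes> h \<in> layer_product G A vs" using ah by simp
  then obtain x where x: "\<forall>s \<in> set vs. x s \<in> carrier (section_group s)"
      "coset_product G rep vs x = inv (rep s C) \<otimes> a \<otimes> h"
    using Cons.IH[of "us @ [s]"] Cons.prems by auto
  define x' where "x' = x(s := C)"
  have x': "x' s = C" "\<forall>t \<in> set vs. x' t = x t" using s(2) unfolding x'_def by auto
  have "coset_product G rep (s # vs) x' = rep s C \<otimes> (inv (rep s C) \<otimes> a \<otimes> h)"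
    using x' x(2) coset_product_cong[of vs x' x G rep] by simp
  also have "\<dots> = g" using r ah by (simp flip: m_assoc)
  finally show ?case using x x' C by (intro exI[of _ x']) simp
qed simp

text \<open>If \<open>r h = r' h'\<close>, then the quotient of \<open>r\<close> and \<open>r'\<close> lies in the first layer and in the product of
  the later ones, hence in \<open>B s\<close>; so \<open>r\<close> and \<open>r'\<close> represent the same coset.\<close>

lemma coset_product_inj:
  assumes "ss = us @ vs" "coset_product G rep vs x = coset_product G rep vs y"
    and "\<And>s. s \<in> set vs \<Longrightarrow> x s \<in> carrier (section_group s)"
    and "\<And>s. s \<in> set vs \<Longrightarrow> y s \<in> carrier (section_group s)"
  shows "\<forall>s \<in> set vs. x s = y s"
  using assms
proof (induction vs arbitrary: us)
  case (Cons s vs)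
  then have s: "s \<in> set ss" by auto
  have ss: "ss = (us @ [s]) @ vs" using Cons.prems by simp
  interpret A: normal "A s" G by (rule A_normal[OF s])
  interpret B: normal "B s" G by (rule B_normal[OF s])
  interpret H: normal "layer_product G A vs" G by (rule layer_product_normal[OF ss])
  let ?h = "coset_product G rep vs x" and ?k = "coset_product G rep vs y"
  have hk: "?h \<in> layer_product G A vs" "?k \<in> layer_product G A vs"
    using Cons.prems by (auto intro!: coset_product_mem[OF ss])
  have r: "rep s (x s) \<in> A s" "B s #> rep s (x s) = x s" "rep s (y s) \<in> A s" "B s #> rep s (y s) = y s"
    using Cons.prems by (auto intro!: rep_in_A[OF s])
  have eq: "rep s (x s) \<otimes> ?h = rep s (y s) \<otimes> ?k" using Cons.prems(2) by simp
  have "inv (rep s (y s)) \<otimes> rep s (x s) = ?k \<otimes> inv ?h"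
  proof -
    have c: "rep s (x s) \<in> carrier G" "rep s (y s) \<in> carrier G" "?h \<in> carrier G" "?k \<in> carrier G"
      using r hk by auto
    have "inv (rep s (y s)) \<otimes> rep s (x s) = inv (rep s (y s)) \<otimes> (rep s (x s) \<otimes> ?h) \<otimes> inv ?h"
      using c by (simp add: m_assoc)
    also have "\<dots> = ?k \<otimes> inv ?h"
      unfolding eq using c by (simp flip: m_assoc)
    finally show ?thesis .
  qed
  moreover have "inv (rep s (y s)) \<otimes> rep s (x s) \<in> A s" "?k \<otimes> inv ?h \<in> layer_product G A vs"
    using r hk by auto
  ultimately have "inv (rep s (y s)) \<otimes> rep s (x s) \<in> B s"
    using layer_meet[OF Cons.prems(1)] by auto
  then have "rep s (y s) \<otimes> (inv (rep s (y s)) \<otimes> rep s (x s)) \<otimes> inv (rep s (y s)) \<in> B s"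
    using r B.inv_op_closed2 by simp
  then have "rep s (x s) \<otimes> inv (rep s (y s)) \<in> B s" using r by (simp flip: m_assoc)
  then have xy: "x s = y s" using r B.r_coset_eq_iff[of "rep s (x s)" "rep s (y s)"] by simp
  then have "?h = ?k" using eq r hk by simp
  then show ?case using Cons.IH[OF ss] Cons.prems xy by auto
qed simp

end

section \<open>Generators of a direct sum\<close>

definition sum_group_single :: "'i set \<Rightarrow> ('i \<Rightarrow> ('a, 'b) monoid_scheme) \<Rightarrow> 'i \<Rightarrow> 'a \<Rightarrow> 'i \<Rightarrow> 'a" where
  "sum_group_single I Q s c = (\<lambda>t\<in>I. if t = s then c else \<one>\<^bsub>Q t\<^esub>)"

lemma sum_group_single_hom:
  assumes Q: "\<And>s. s \<in> I \<Longrightarrow> group (Q s)" and s: "s \<in> I"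
  shows "group_hom (Q s) (sum_group I Q) (sum_group_single I Q s)"
proof -
  have one: "\<one>\<^bsub>Q t\<^esub> \<in> carrier (Q t)" "\<one>\<^bsub>Q t\<^esub> \<otimes>\<^bsub>Q t\<^esub> \<one>\<^bsub>Q t\<^esub> = \<one>\<^bsub>Q t\<^esub>" if "t \<in> I" for t
    using Q[OF that] group.is_monoid monoid.one_closed monoid.l_one by metis+
  have "finite {t \<in> I. sum_group_single I Q s c t \<noteq> \<one>\<^bsub>Q t\<^esub>}" for c
    by (rule finite_subset[of _ "{s}"]) (auto simp: sum_group_single_def)
  then show ?thesis
    using Q s one
    by (auto simp: group_hom_def group_hom_axioms_def hom_def carrier_sum_group sum_group_single_def fun_eq_iff)
qed

text \<open>Only the finitely many indices of \<open>ss\<close> matter, so an element is split off one coordinate at a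
  time.\<close>

lemma generate_sum_group:
  assumes Q: "\<And>s. s \<in> I \<Longrightarrow> group (Q s)"
    and ss: "set ss \<subseteq> I" and trivial: "\<And>s. s \<in> I - set ss \<Longrightarrow> carrier (Q s) = {\<one>\<^bsub>Q s\<^esub>}"
    and gens: "\<And>s. s \<in> set ss \<Longrightarrow> gs s \<subseteq> carrier (Q s)"
      "\<And>s. s \<in> set ss \<Longrightarrow> generate (Q s) (gs s) = carrier (Q s)"
  shows "generate (sum_group I Q) (\<Union>s \<in> set ss. sum_group_single I Q s ` gs s) = carrier (sum_group I Q)"
    (is "generate ?L ?gens = _")
proof
  interpret L: group ?L using Q by simp
  have "sum_group_single I Q s c \<in> carrier ?L" if "s \<in> I" "c \<in> carrier (Q s)" for s c
    using group_hom.hom_closed[OF sum_group_single_hom] Q that by metis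
  then have gens_carrier: "?gens \<subseteq> carrier ?L" using gens(1) ss by blast
  then show "generate ?L ?gens \<subseteq> carrier ?L" by (rule L.generate_incl)
  have single: "sum_group_single I Q s c \<in> generate ?L ?gens" if "s \<in> set ss" "c \<in> carrier (Q s)" for s c
  proof -
    interpret h: group_hom "Q s" ?L "sum_group_single I Q s"
      using Q by (rule sum_group_single_hom) (use ss that in auto)
    have "sum_group_single I Q s c \<in> generate ?L (sum_group_single I Q s ` gs s)"
      using h.generate_img gens[OF that(1)] that(2) by blast
    also have "\<dots> \<subseteq> generate ?L ?gens" using that(1) by (intro L.mono_generate) blast
    finally show ?thesis .
  qed
  have "x \<in> generate ?L ?gens"
    if "x \<in> carrier ?L" "set vs \<subseteq> set ss" "\<And>t. t \<in> I - set vs \<Longrightarrow> x t = \<one>\<^bsub>Q t\<^esub>" for x vs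
    using that
  proof (induction vs arbitrary: x)
    case Nil
    then have "x = \<one>\<^bsub>?L\<^esub>" using Q by (auto simp: carrier_sum_group PiE_iff extensional_def fun_eq_iff)
    then show ?case by (simp only: generate.one)
  next
    case (Cons s vs)
    define y where "y = (\<lambda>t\<in>I. if t = s then \<one>\<^bsub>Q t\<^esub> else x t)"
    have s: "s \<in> I" "s \<in> set ss" using Cons.prems(2) ss by auto
    have x: "x \<in> extensional I" "\<And>t. t \<in> I \<Longrightarrow> x t \<in> carrier (Q t)" "finite {t \<in> I. x t \<noteq> \<one>\<^bsub>Q t\<^esub>}"
      using Cons.prems(1) Q by (auto simp: carrier_sum_group PiE_iff)
    have one: "\<one>\<^bsub>Q t\<^esub> \<in> carrier (Q t)" "c \<in> carrier (Q t) \<Longrightarrow> \<one>\<^bsub>Q t\<^esub> \<otimes>\<^bsub>Q t\<^esub> c = c"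
       "c \<in> carrier (Q t) \<Longrightarrow> c \<otimes>\<^bsub>Q t\<^esub> \<one>\<^bsub>Q t\<^esub> = c" if "t \<in> I" for t c
      using Q[OF that] group.is_monoid monoid.one_closed monoid.l_one monoid.r_one by metis+
    have "finite {t \<in> I. y t \<noteq> \<one>\<^bsub>Q t\<^esub>}"
      by (rule finite_subset[OF _ x(3)]) (auto simp: y_def)
    then have y: "y \<in> carrier ?L" using x one Q by (auto simp: carrier_sum_group y_def)
    have "y \<in> generate ?L ?gens"
    proof (rule Cons.IH[OF y])
      show "y t = \<one>\<^bsub>Q t\<^esub>" if "t \<in> I - set vs" for t
        using Cons.prems(3)[of t] that by (auto simp: y_def)
    qed (use Cons.prems in auto)
    moreover have eq: "sum_group_single I Q s (x s) \<otimes>\<^bsub>?L\<^esub> y = x"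
      using x one s by (auto simp: sum_group_single_def y_def fun_eq_iff extensional_def)
    ultimately show ?case
      using generate.eng[OF single[OF s(2) x(2)[OF s(1)]], of y] unfolding eq by blast
  qed
  moreover have "x t = \<one>\<^bsub>Q t\<^esub>" if "x \<in> carrier ?L" "t \<in> I - set ss" for x t
  proof -
    have "x \<in> (\<Pi>\<^sub>E i\<in>I. carrier (Q i))" using that(1) Q by (simp add: carrier_sum_group)
    then have "x t \<in> carrier (Q t)" using that(2) by auto
    then show ?thesis unfolding trivial[OF that(2)] by simp
  qed
  ultimately show "carrier ?L \<subseteq> generate ?L ?gens" by blast
qed

lemma comm_group_sum_group:
  assumes Q: "\<And>s. s \<in> I \<Longrightarrow> comm_group (Q s)"
  shows "comm_group (sum_group I Q)"
proof -
  have groups: "\<And>s. s \<in> I \<Longrightarrow> group (Q s)" using Q comm_group.axioms(2) by blast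
  interpret L: group "sum_group I Q" using groups by simp
  show ?thesis
  proof (rule L.group_comm_groupI)
    fix x y assume "x \<in> carrier (sum_group I Q)" "y \<in> carrier (sum_group I Q)"
    then have "x s \<otimes>\<^bsub>Q s\<^esub> y s = y s \<otimes>\<^bsub>Q s\<^esub> x s" if "s \<in> I" for s
      using groups comm_monoid.m_comm[OF comm_group.axioms(1)[OF Q[OF that]]] that
      by (auto simp: carrier_sum_group PiE_iff)
    then show "x \<otimes>\<^bsub>sum_group I Q\<^esub> y = y \<otimes>\<^bsub>sum_group I Q\<^esub> x" by (auto simp: fun_eq_iff)
  qed
qed

section \<open>A layered group and the direct sum of its sections\<close>

context layered_group_with_representatives
begin

lemma coset_product_single:
  assumes "set vs \<subseteq> I" "distinct vs" "set vs \<subseteq> set ss" "s \<in> set ss" "c \<in> carrier (section_group s)"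
    and one: "\<And>t. t \<in> set ss \<Longrightarrow> rep t (B t) = \<one>"
  shows "coset_product G rep vs (sum_group_single I section_group s c) = (if s \<in> set vs then rep s c else \<one>)"
proof -
  have "rep s c \<in> carrier G"
    using rep_in_A(1)[OF assms(4,5)] subgroup.mem_carrier[OF normal_imp_subgroup[OF A_normal]] assms(4)
    by blast
  then show ?thesis
    using assms(1-3) one by (induction vs) (auto simp: sum_group_single_def)
qed

text \<open>Coordinates outside \<open>ss\<close> are forced, since the section there is trivial; the coordinates in
  \<open>ss\<close> can be prescribed and are determined by the product.\<close>

lemma coset_product_bij:
  assumes I: "set ss \<subseteq> I" and full: "layer_product G A ss = carrier G"
    and trivial: "\<And>s. s \<in> I - set ss \<Longrightarrow> carrier (section_group s) = {B s}"
    and groups: "\<And>s. s \<in> I \<Longrightarrow> group (section_group s)"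
  shows "bij_betw (coset_product G rep ss) (carrier (sum_group I section_group)) (carrier G)"
proof -
  have carrier: "carrier (sum_group I section_group) =
      {x \<in> \<Pi>\<^sub>E s\<in>I. carrier (section_group s). finite {s \<in> I. x s \<noteq> B s}}"
    using groups by (simp add: carrier_sum_group)
  show ?thesis
    unfolding bij_betw_def
  proof (intro conjI equalityI subsetI inj_onI)
    fix x y
    assume x: "x \<in> carrier (sum_group I section_group)" and y: "y \<in> carrier (sum_group I section_group)"
      and eq: "coset_product G rep ss x = coset_product G rep ss y"
    have "\<forall>s \<in> set ss. x s = y s"
      using x y I unfolding carrier by (intro coset_product_inj[of "[]", OF _ eq]) auto
    moreover have "\<forall>s \<in> I - set ss. x s = y s"
    proof
      fix s assume s: "s \<in> I - set ss"
      then have "x s \<in> carrier (section_group s)" "y s \<in> carrier (section_group s)"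
        using x y unfolding carrier by auto
      then show "x s = y s" unfolding trivial[OF s] by simp
    qed
    ultimately show "x = y"
      using x y unfolding carrier by (intro PiE_ext[of x I _ y]) auto
  next
    fix g assume "g \<in> coset_product G rep ss ` carrier (sum_group I section_group)"
    then show "g \<in> carrier G"
      unfolding full[symmetric] carrier using I by (auto intro!: coset_product_mem[of "[]"])
  next
    fix g assume "g \<in> carrier G"
    then obtain x where x: "\<forall>s \<in> set ss. x s \<in> carrier (section_group s)" "coset_product G rep ss x = g"
      using coset_product_surj[of "[]" ss g] full by auto
    \<comment> \<open>\<open>B s\<close> is the neutral element of the section, so the extended family has finite support.\<close>
    define y where "y = (\<lambda>s\<in>I. if s \<in> set ss then x s else B s)"
    have "finite {s \<in> I. y s \<noteq> B s}"
      by (rule finite_subset[of _ "set ss"]) (auto simp: y_def)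
    then have "y \<in> carrier (sum_group I section_group)"
      using x trivial unfolding carrier by (auto simp: y_def)
    moreover have "\<forall>s \<in> set ss. y s = x s" using I by (auto simp: y_def)
    then have "coset_product G rep ss y = g"
      unfolding x(2)[symmetric] by (rule coset_product_cong)
    ultimately show "g \<in> coset_product G rep ss ` carrier (sum_group I section_group)" by blast
  qed
qed

end

context layered_group
begin

text \<open>Each \<open>l s\<close> generates \<open>A s\<close> modulo \<open>B s\<close>, and \<open>B s\<close> lies in the product of the later layers, so
  the tails of the concatenated list catch up with every layer in turn.\<close>

lemma layer_product_generators:
  assumes l: "\<And>s. s \<in> set ss \<Longrightarrow> set (l s) \<subseteq> A s"
    "\<And>s. s \<in> set ss \<Longrightarrow> A s \<subseteq> generate G (set (l s) \<union> B s)"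
    and "ss = us @ vs"
  shows "generate G (set (concat (map l vs))) = layer_product G A vs \<and>
         subnormal_list G (concat (map l vs))"
  using assms(3)
proof (induction vs arbitrary: us)
  case Nil
  then show ?case by (simp add: generate_empty)
next
  case (Cons s vs)
  have ss: "ss = (us @ [s]) @ vs" and s: "s \<in> set ss" using Cons.prems by auto
  let ?H = "layer_product G A vs" and ?as = "concat (map l vs)"
  have gen: "generate G (set ?as) = ?H" and sub: "subnormal_list G ?as"
    using Cons.IH[OF ss] by auto
  have A: "subgroup (A s) G" using A_normal[OF s] by (rule normal_imp_subgroup)
  have H: "?H \<lhd> G" using ss by (rule layer_product_normal)
  have AH: "subgroup (A s <#> ?H) G"
    using normal_subgroup_set_mult_closed[OF A_normal[OF s] H] by (rule normal_imp_subgroup)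
  have as: "set ?as \<subseteq> ?H" using gen generate_superset[of "set ?as" G] by simp
  have lA: "set (l s) \<subseteq> A s" using l(1) s .
  have list: "set (l s) \<union> set ?as \<subseteq> A s <#> ?H"
    using lA as set_mult_supset[OF A normal_imp_subgroup[OF H]] by auto
  have c: "set (l s) \<union> set ?as \<subseteq> carrier G" using list subgroup.subset[OF AH] by (rule subset_trans)
  let ?K = "generate G (set (l s) \<union> set ?as)"
  have K: "subgroup ?K G" using c by (rule generate_is_subgroup)
  have HK: "?H \<subseteq> ?K" unfolding gen[symmetric] by (rule mono_generate) auto
  have "set (l s) \<union> B s \<subseteq> ?K"
    using HK B_subset_layer_product[OF Cons.prems] generate_superset[of "set (l s) \<union> set ?as" G] by auto
  then have "A s \<subseteq> ?K"
    using l(2)[OF s] generate_subgroup_incl[OF _ K] by blast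
  then have "A s <#> ?H \<subseteq> ?K"
    using HK subgroup.m_closed[OF K] by (fastforce simp: set_mult_def)
  moreover have "?K \<subseteq> A s <#> ?H" using list AH by (rule generate_subgroup_incl)
  moreover have "subnormal_list G (l s @ ?as)"
  proof (rule subnormal_list_append[OF sub _ _ subgroup.subset[OF A] lA])
    show "set ?as \<subseteq> carrier G" using c by auto
    show "generate G (set ?as) \<lhd> G" using gen H by simp
    fix x y assume "x \<in> A s" "y \<in> A s"
    then show "x \<otimes> y \<otimes> inv x \<otimes> inv y \<in> generate G (set ?as)"
      using layer_abelian[OF s] B_subset_layer_product[OF Cons.prems] gen by blast
  qed
  ultimately show ?case by auto
qed

lemma trivial_section:
  assumes "A s \<lhd> G" "A s = B s"
  shows "carrier (section_group s) = {B s}" "comm_group (section_group s)"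
proof -
  have sub: "subgroup (B s) G" using normal_imp_subgroup assms by fastforce
  then have "B s #> x = B s" if "x \<in> B s" for x
    using coset_join2[OF subgroup.mem_carrier[OF sub that] sub that] by simp
  moreover have "B s \<noteq> {}" using sub subgroup.one_closed by blast
  ultimately show carrier: "carrier (section_group s) = {B s}"
    using carrier_section[of s] assms(2) by auto
  have "B s \<lhd> G\<lparr>carrier := A s\<rparr>"
    using normal_restrict_supergroup[OF sub] assms by fastforce
  then interpret Q: group "section_group s" by (rule normal.factorgroup_is_group)
  show "comm_group (section_group s)" by (rule Q.group_comm_groupI) (simp add: carrier)
qed

lemma section_finitely_generated:
  assumes noeth: "noetherian_in G (carrier G)" and s: "s \<in> set ss"
  shows "\<exists>qs. set qs \<subseteq> carrier (section_group s) \<and>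
              generate (section_group s) (set qs) = carrier (section_group s)"
proof -
  interpret B: normal "B s" "G\<lparr>carrier := A s\<rparr>" by (rule B_normal_A[OF s])
  interpret \<pi>: group_hom "G\<lparr>carrier := A s\<rparr>" "section_group s"
    "\<lambda>x. B s #>\<^bsub>G\<lparr>carrier := A s\<rparr>\<^esub> x" by (rule B.group_hom_Mod)
  have A: "subgroup (A s) G" using A_normal[OF s] by (rule normal_imp_subgroup)
  then obtain F where F: "finite F" "generate G F = A s"
    using noeth subgroup.subset[OF A] unfolding noetherian_in_def by auto
  have FA: "F \<subseteq> A s" using F(2) generate_superset[of F G] by simp
  obtain qs where qs: "set qs = (\<lambda>x. B s #> x) ` F" using F(1) finite_list by (metis finite_imageI)
  have "generate (G\<lparr>carrier := A s\<rparr>) F = A s" using generate_consistent[OF FA A] F(2) by simp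
  then have "generate (section_group s) (set qs) = carrier (section_group s)"
    using \<pi>.generate_img[of F] FA by (simp add: qs carrier_section)
  moreover have "set qs \<subseteq> carrier (section_group s)" using qs FA by (auto simp: carrier_section)
  ultimately show ?thesis by blast
qed

text \<open>The representative of the trivial coset is taken to be \<open>\<one>\<close>. Then the element of the direct sum with
  a single nontrivial coordinate \<open>C\<close> is sent to the representative of \<open>C\<close>, which is how the
  bijection carries one generating list to the other.\<close>

theorem bijection_of_pcgs:
  assumes noeth: "noetherian_in G (carrier G)"
    and I: "set ss \<subseteq> I" and full: "layer_product G A ss = carrier G"
    and normal: "\<And>s. s \<in> I \<Longrightarrow> A s \<lhd> G" and trivial: "\<And>s. s \<in> I - set ss \<Longrightarrow> A s = B s"
  shows "\<exists>f. bij_betw f (carrier (sum_group I section_group)) (carrier G) \<and>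
             (\<exists>as. pcgs (sum_group I section_group) as \<and> pcgs G (map f as))"
proof -
  have one: "carrier (section_group s) = {B s}" "comm_group (section_group s)" if "s \<in> I - set ss" for s
  proof -
    have "A s \<lhd> G" "A s = B s" using normal[of s] trivial[OF that] that by simp_all
    then show "carrier (section_group s) = {B s}" "comm_group (section_group s)"
      by (rule trivial_section)+
  qed
  have comm: "comm_group (section_group s)" if "s \<in> I" for s
    using comm_group_section one(2) that by blast
  then have groups: "group (section_group s)" if "s \<in> I" for s
    using that comm_group.axioms(2) by blast
  let ?L = "sum_group I section_group"
  interpret L: comm_group ?L using comm by (rule comm_group_sum_group)
  define rep where "rep s C = (if C = B s then \<one> else SOME x. x \<in> C)" for s C
  interpret layered_group_with_representatives G A B ss rep
  proof
    fix s C assume s: "s \<in> set ss" and "C \<in> carrier (section_group s)"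
    then obtain a where a: "a \<in> A s" "C = B s #> a" unfolding carrier_section by blast
    have B: "subgroup (B s) G" using normal_imp_subgroup B_normal s by blast
    then have "\<exists>x. x \<in> C"
      using a rcos_self[OF _ B] subgroup.mem_carrier[OF normal_imp_subgroup[OF A_normal[OF s]]] by blast
    then show "rep s C \<in> C"
      unfolding rep_def using subgroup.one_closed[OF B] by (auto intro: someI_ex)
  qed
  have rep_one: "rep s (B s) = \<one>" for s unfolding rep_def by simp
  let ?f = "coset_product G rep ss"
  have bij: "bij_betw ?f (carrier ?L) (carrier G)"
    using I full one(1) groups by (rule coset_product_bij)
  obtain qs where qs: "\<And>s. s \<in> set ss \<Longrightarrow> set (qs s) \<subseteq> carrier (section_group s)"
    "\<And>s. s \<in> set ss \<Longrightarrow> generate (section_group s) (set (qs s)) = carrier (section_group s)"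
    using section_finitely_generated[OF noeth] by metis
  define as where "as = concat (map (\<lambda>s. map (sum_group_single I section_group s) (qs s)) ss)"
  have set_as: "set as = (\<Union>s \<in> set ss. sum_group_single I section_group s ` set (qs s))"
    unfolding as_def by auto
  have gen: "generate ?L (set as) = carrier ?L"
    unfolding set_as using I one groups qs by (intro generate_sum_group) auto
  then have "set as \<subseteq> carrier ?L" using generate_superset[of "set as" ?L] by simp
  then have pcgs_L: "pcgs ?L as" using gen by (rule L.pcgs_of_generating_list)
  define l where "l s = map (rep s) (qs s)" for s
  have "?f (sum_group_single I section_group s c) = rep s c" if "s \<in> set ss" "c \<in> set (qs s)" for s c
    using coset_product_single[OF I distinct subset_refl that(1)] qs(1) that rep_one by auto
  then have map_as: "map ?f as = concat (map l ss)"
    unfolding as_def l_def map_concat by (auto simp: comp_def intro!: arg_cong[of _ _ concat])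
  have lA: "set (l s) \<subseteq> A s" if s: "s \<in> set ss" for s
    using rep_in_A(1)[OF s] qs(1)[OF s] unfolding l_def by auto
  have gen_A: "A s \<subseteq> generate G (set (l s) \<union> B s)" if s: "s \<in> set ss" for s
  proof
    fix a assume a: "a \<in> A s"
    interpret B: normal "B s" G by (rule B_normal[OF s])
    interpret \<pi>: group_hom G "G Mod B s" "\<lambda>x. B s #> x" by (rule B.group_hom_Mod)
    interpret BA: normal "B s" "G\<lparr>carrier := A s\<rparr>" by (rule B_normal_A[OF s])
    interpret \<pi>A: group_hom "G\<lparr>carrier := A s\<rparr>" "section_group s"
      "\<lambda>x. B s #>\<^bsub>G\<lparr>carrier := A s\<rparr>\<^esub> x" by (rule BA.group_hom_Mod)
    have A: "subgroup (A s) G" using A_normal[OF s] by (rule normal_imp_subgroup)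
    let ?K = "generate G (set (l s) \<union> B s)"
    have c: "set (l s) \<union> B s \<subseteq> carrier G" using lA[OF s] subgroup.subset[OF A] by auto
    then have K: "subgroup ?K G" by (rule generate_is_subgroup)
    have "(\<lambda>x. B s #> x) ` set (l s) = set (qs s)"
    proof -
      have "(\<lambda>x. B s #> x) ` set (l s) = (\<lambda>C. B s #> rep s C) ` set (qs s)"
        by (simp add: l_def image_image)
      also have "\<dots> = (\<lambda>C. C) ` set (qs s)"
        using qs(1)[OF s] by (intro image_cong refl rep_in_A(2)[OF s]) auto
      finally show ?thesis by simp
    qed
    then have "generate (section_group s) (set (qs s)) = (\<lambda>x. B s #> x) ` generate (G\<lparr>carrier := A s\<rparr>) (set (l s))"
      using \<pi>A.generate_img[of "set (l s)"] lA[OF s] by simp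
    also have "\<dots> = (\<lambda>x. B s #> x) ` generate G (set (l s))"
      using generate_consistent[OF lA[OF s] A] by simp
    finally have "carrier (section_group s) = (\<lambda>x. B s #> x) ` generate G (set (l s))"
      unfolding qs(2)[OF s] .
    then have "B s #> a \<in> (\<lambda>x. B s #> x) ` generate G (set (l s))"
      using a unfolding carrier_section by blast
    \<comment> \<open>The chosen representatives hit every coset, and \<open>B s\<close> supplies the rest.\<close>
    then obtain k where "k \<in> generate G (set (l s))" and eq: "B s #> a = B s #> k" by blast
    then have k: "k \<in> ?K" using mono_generate[of "set (l s)" "set (l s) \<union> B s"] by blast
    have ac: "a \<in> carrier G" "k \<in> carrier G"
      using a k subgroup.mem_carrier[OF A] subgroup.mem_carrier[OF K] by auto
    then have "a \<otimes> inv k \<in> ?K"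
      using eq B.r_coset_eq_iff[OF ac] generate_superset[of "set (l s) \<union> B s" G] by auto
    then have "a \<otimes> inv k \<otimes> k \<in> ?K" using k subgroup.m_closed[OF K] by blast
    then show "a \<in> ?K" using ac by (simp add: m_assoc)
  qed
  have "pcgs G (concat (map l ss))"
  proof (rule pcgs_of_subnormal_list)
    show "generate G (set (concat (map l ss))) = carrier G" "subnormal_list G (concat (map l ss))"
      using layer_product_generators[OF lA gen_A, of "[]" ss] full by auto
    then show "set (concat (map l ss)) \<subseteq> carrier G"
      using generate_superset[of "set (concat (map l ss))" G] by simp
  qed
  then have "pcgs G (map ?f as)" unfolding map_as .
  then show ?thesis using bij pcgs_L by blast
qed

end

section \<open>Faithful inertia-free filters\<close>

text \<open>Repeatedly take a maximal value first.\<close>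

lemma inclusion_antisorted_enumeration:
  fixes f :: "'s \<Rightarrow> 'a set"
  assumes "finite S" "inj_on f S"
  shows "\<exists>ss. distinct ss \<and> set ss = S \<and> sorted_wrt (\<lambda>s t. \<not> f s \<subseteq> f t) ss"
  using assms
proof (induction S rule: finite_psubset_induct)
  case (psubset S)
  show ?case
  proof (cases "S = {}")
    case False
    then obtain m where m: "m \<in> S" "\<And>t. t \<in> S \<Longrightarrow> f m \<subseteq> f t \<Longrightarrow> f m = f t"
      using finite_has_maximal[of "f ` S"] psubset.hyps by auto
    then obtain ss where ss: "distinct ss" "set ss = S - {m}" "sorted_wrt (\<lambda>s t. \<not> f s \<subseteq> f t) ss"
      using psubset.IH[of "S - {m}"] psubset.prems by (auto intro: inj_on_diff)
    have "\<not> f m \<subseteq> f t" if "t \<in> set ss" for t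
      using m(2)[of t] that ss(2) psubset.prems m(1) by (auto dest: inj_onD)
    then show ?thesis using ss m(1) by (intro exI[of _ "m # ss"]) auto
  qed auto
qed

lemma (in group) generate_Un_normal:
  assumes A: "A \<lhd> G" and S: "S \<subseteq> carrier G" "generate G S \<lhd> G"
  shows "generate G (A \<union> S) = A <#> generate G S"
proof
  have c: "A \<union> S \<subseteq> carrier G" using S normal_imp_subgroup[OF A] subgroup.subset by auto
  note supset = set_mult_supset[OF A[THEN normal_imp_subgroup] S(2)[THEN normal_imp_subgroup]]
  show "generate G (A \<union> S) \<subseteq> A <#> generate G S"
    using supset generate_superset[of S G] normal_subgroup_set_mult_closed[OF A S(2)]
    by (intro generate_subgroup_incl normal_imp_subgroup) auto
  have "x \<otimes> y \<in> generate G (A \<union> S)" if "x \<in> A" "y \<in> generate G S" for x y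
    using that generate_superset[of "A \<union> S" G] mono_generate[of S "A \<union> S"]
    by (intro generate.eng) auto
  then show "A <#> generate G S \<subseteq> generate G (A \<union> S)" by (auto simp: set_mult_def)
qed

text \<open>The parameter \<open>Y\<close> is a fixed witness of faithfulness. Since \<open>H \<inter> Y\<close> generates \<open>H\<close>, members of
  the lattice can be compared by their traces on \<open>Y\<close>.\<close>

locale faithful_inertia_free_filter = group_filter M le G \<phi>
  for M :: "('m, 'c) monoid_scheme" (structure)
    and le :: "'m \<Rightarrow> 'm \<Rightarrow> bool" (infix \<open>\<preceq>\<close> 50)
    and G :: "('a, 'b) monoid_scheme" (structure)
    and \<phi> :: "'m \<Rightarrow> 'a set" +
  fixes Y :: "'a set"
  assumes finite_image: "finite (\<phi> ` carrier M)"
    and inertia_free: "(\<Union>i. inertia_level M G \<phi> i) = \<phi> ` carrier M"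
    and Y_carrier: "Y \<subseteq> carrier G"
    and generate_Int_Y: "H \<in> filter_lattice M G \<phi> \<Longrightarrow> generate G (H \<inter> Y) = H"
    and set_mult_Int_Y: "H \<in> filter_lattice M G \<phi> \<Longrightarrow> K \<in> filter_lattice M G \<phi> \<Longrightarrow>
      (H <#>\<^bsub>G\<^esub> K) \<inter> Y = (H \<inter> Y) \<union> (K \<inter> Y)"
    and unique_degree: "x \<in> Y \<Longrightarrow> \<exists>!s. s \<in> carrier M \<and> x \<in> \<phi> s - filter_boundary M G \<phi> s"
begin

abbreviation boundary ("\<partial>") where "\<partial> \<equiv> filter_boundary M G \<phi>"
abbreviation lattice where "lattice \<equiv> filter_lattice M G \<phi>"

lemma lattice_normal: "H \<in> lattice \<Longrightarrow> H \<lhd> G"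
  by (induction rule: filter_lattice.induct)
     (auto intro: normal G.normal_subgroup_intersect G.normal_subgroup_set_mult_closed)

lemma lattice_carrier: "H \<in> lattice \<Longrightarrow> H \<subseteq> carrier G"
  using subgroup.subset[OF normal_imp_subgroup[OF lattice_normal]] .

lemma lattice_eqI: "H \<in> lattice \<Longrightarrow> K \<in> lattice \<Longrightarrow> H \<inter> Y = K \<inter> Y \<Longrightarrow> H = K"
  using generate_Int_Y by metis

lemma lattice_Inter: "finite \<A> \<Longrightarrow> \<A> \<noteq> {} \<Longrightarrow> \<A> \<subseteq> lattice \<Longrightarrow> \<Inter>\<A> \<in> lattice"
  by (induction rule: finite_ne_induct) (auto intro: filter_lattice.inter)

lemma one_in_lattice: "{\<one>\<^bsub>G\<^esub>} \<in> lattice"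
  using lattice_Inter[OF finite_image] trivial_Inter by (auto intro: filter_lattice.base)

text \<open>The neutral element lies in every boundary, so it has no degree. This makes the empty join
  behave like the empty union.\<close>

lemma one_notin_Y: "\<one>\<^bsub>G\<^esub> \<notin> Y"
  using unique_degree[of "\<one>\<^bsub>G\<^esub>"] generate.one[of G] unfolding filter_boundary_def by auto

text \<open>Boundaries are joins of several subgroups, while the join condition on \<open>Y\<close> speaks of two;
  adjoining one subgroup at a time extends it to finite families.\<close>

lemma lattice_generate:
  assumes "finite \<A>" "\<A> \<subseteq> lattice"
  shows "generate G (\<Union>\<A>) \<in> lattice \<and> generate G (\<Union>\<A>) \<inter> Y = \<Union>\<A> \<inter> Y"
  using assms
proof (induction rule: finite_induct)
  case empty
  then show ?case using one_in_lattice one_notin_Y by (simp add: G.generate_empty)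
next
  case (insert A \<A>)
  then have IH: "generate G (\<Union>\<A>) \<in> lattice" "generate G (\<Union>\<A>) \<inter> Y = \<Union>\<A> \<inter> Y" and A: "A \<in> lattice"
    by auto
  have "K \<subseteq> carrier G" if "K \<in> \<A>" for K
    using insert.prems that by (intro lattice_carrier) auto
  then have "generate G (A \<union> \<Union>\<A>) = A <#>\<^bsub>G\<^esub> generate G (\<Union>\<A>)"
    using A IH(1) by (intro G.generate_Un_normal lattice_normal) auto
  then show ?case
    using filter_lattice.mult[OF A IH(1)] set_mult_Int_Y[OF A IH(1)] IH(2) by auto
qed

lemma boundary_lattice:
  assumes "s \<in> carrier M" shows "\<partial> s \<in> lattice"
proof -
  let ?\<A> = "(\<lambda>t. \<phi> (s \<otimes> t)) ` (carrier M - {\<one>})"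
  have "?\<A> \<subseteq> \<phi> ` carrier M" using assms by auto
  moreover have "\<phi> ` carrier M \<subseteq> lattice" by (auto intro: filter_lattice.base)
  ultimately have "finite ?\<A>" "?\<A> \<subseteq> lattice"
    using finite_subset[OF _ finite_image] by auto
  then show ?thesis using lattice_generate unfolding filter_boundary_def by blast
qed

lemma boundary_subset:
  assumes "s \<in> carrier M" shows "\<partial> s \<subseteq> \<phi> s"
proof -
  have "\<phi> (s \<otimes> t) \<subseteq> \<phi> s" if "t \<in> carrier M" for t
  proof (rule antimono)
    have "s \<otimes> \<one> \<preceq> s \<otimes> t"
      using assms that le_refl one_le by (intro le_mult) (auto simp: reflp_on_def)
    then show "s \<preceq> s \<otimes> t" using assms by simp
  qed (use assms that in auto)
  then show ?thesis
    unfolding filter_boundary_def using normal_imp_subgroup[OF normal[OF assms]]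
    by (intro G.generate_subgroup_incl) auto
qed

text \<open>The values of \<open>\<phi>\<close> at nontrivial elements of \<open>M\<close> generate \<open>G\<close>, and they are what the boundary at \<open>\<one>\<close>
  joins; so no element of \<open>Y\<close> has degree \<open>\<one>\<close>.\<close>

lemma boundary_one: "\<partial> \<one> = carrier G" "\<phi> \<one> = carrier G"
proof -
  have "(\<Union>t \<in> carrier M - {\<one>}. \<phi> (\<one> \<otimes> t)) = (\<Union>t \<in> carrier M - {\<one>}. \<phi> t)" by auto
  then show "\<partial> \<one> = carrier G" unfolding filter_boundary_def using generates by simp
  then show "\<phi> \<one> = carrier G"
    using boundary_subset[OF one_closed] normal_imp_subgroup[OF normal[OF one_closed]]
      subgroup.subset by blast
qed

definition degree :: "'a \<Rightarrow> 'm" where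
  "degree x = (THE s. s \<in> carrier M \<and> x \<in> \<phi> s - \<partial> s)"

lemma degree:
  assumes "x \<in> Y"
  shows "degree x \<in> carrier M" "x \<in> \<phi> (degree x)" "x \<notin> \<partial> (degree x)"
  using theI'[OF unique_degree[OF assms]] unfolding degree_def by auto

lemma degree_eqI: "x \<in> Y \<Longrightarrow> s \<in> carrier M \<Longrightarrow> x \<in> \<phi> s \<Longrightarrow> x \<notin> \<partial> s \<Longrightarrow> degree x = s"
  using the1_equality[OF unique_degree] unfolding degree_def by auto

lemma inertia_level_subset: "inertia_level M G \<phi> i \<subseteq> insert {\<one>\<^bsub>G\<^esub>} (\<phi> ` carrier M)"
  by (cases i) (auto simp: G.generate_one)

text \<open>The induction is the descent that inertia-freeness makes finite. At level \<open>i + 1\<close> the subgroup is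
  some \<open>\<phi> s\<close> whose boundary is a join of subgroups of level \<open>i\<close>. Either \<open>x\<close> avoids the boundary, and
  then \<open>s\<close> is its degree, or \<open>x\<close> lies in one of those subgroups. At level 0 only the trivial
  subgroup is left, and it contains no element of \<open>Y\<close>.\<close>

lemma degree_subset_inertia_level:
  assumes "H \<in> inertia_level M G \<phi> i" "x \<in> H" "x \<in> Y"
  shows "\<phi> (degree x) \<subseteq> H"
  using assms(1,2)
proof (induction i arbitrary: H)
  case 0
  then show ?case using one_notin_Y assms(3) by (auto simp: G.generate_one)
next
  case (Suc i)
  then obtain s B where s: "s \<in> carrier M" "H = \<phi> s"
    and B: "B \<subseteq> inertia_level M G \<phi> i" "\<partial> s = generate G (\<Union>B)" by auto
  show ?case
  proof (cases "x \<in> \<partial> s")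
    case True
    have "B \<subseteq> insert {\<one>\<^bsub>G\<^esub>} (\<phi> ` carrier M)" using B(1) inertia_level_subset by blast
    then have "finite B" "B \<subseteq> lattice"
      using finite_image one_in_lattice by (auto intro: finite_subset filter_lattice.base)
    then obtain K where K: "K \<in> B" "x \<in> K"
      using lattice_generate[of B] True assms(3) unfolding B(2) by blast
    have "\<phi> (degree x) \<subseteq> K" using Suc.IH K B(1) by blast
    also have "\<dots> \<subseteq> \<partial> s" using K(1) generate_superset[of "\<Union>B" G] unfolding B(2) by blast
    also have "\<dots> \<subseteq> H" using boundary_subset s by simp
    finally show ?thesis .
  next
    case False
    then show ?thesis using degree_eqI assms(3) s Suc.prems(2) by simp
  qed
qed

lemma degree_subset_lattice:
  assumes "H \<in> lattice" "x \<in> H" "x \<in> Y"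
  shows "\<phi> (degree x) \<subseteq> H"
  using assms(1,2)
proof (induction rule: filter_lattice.induct)
  case (base s)
  then obtain i where "\<phi> s \<in> inertia_level M G \<phi> i" using inertia_free by blast
  then show ?case using degree_subset_inertia_level base assms(3) by blast
next
  case (mult H K)
  then have "x \<in> H \<or> x \<in> K" using set_mult_Int_Y[of H K] assms(3) by auto
  moreover have "H \<subseteq> H <#>\<^bsub>G\<^esub> K" "K \<subseteq> H <#>\<^bsub>G\<^esub> K"
    using G.set_mult_supset mult.hyps lattice_normal normal_imp_subgroup by blast+
  ultimately show ?case using mult.IH by blast
qed auto

definition support :: "'m set" where
  "support = {s \<in> carrier M - {\<one>}. \<phi> s \<noteq> \<partial> s}"

lemma degree_in_support:
  assumes "x \<in> Y" shows "degree x \<in> support"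
  using degree[OF assms] boundary_one(1) Y_carrier assms unfolding support_def by auto

lemma support_has_element:
  assumes "s \<in> support"
  obtains x where "x \<in> Y" "x \<in> \<phi> s" "degree x = s"
proof -
  have s: "s \<in> carrier M" "\<phi> s \<noteq> \<partial> s" using assms by (auto simp: support_def)
  then have "\<phi> s \<inter> Y \<noteq> \<partial> s \<inter> Y"
    using lattice_eqI boundary_lattice filter_lattice.base by metis
  then obtain x where "x \<in> \<phi> s" "x \<in> Y" "x \<notin> \<partial> s" using boundary_subset[OF s(1)] by blast
  then show thesis using that degree_eqI s(1) by blast
qed

text \<open>If \<open>\<phi> s = \<phi> t\<close> with \<open>s \<noteq> t\<close>, an element of degree \<open>s\<close> does not have degree \<open>t\<close> and so lies in
  \<open>\<partial> t\<close>, which forces \<open>\<phi> s \<subseteq> \<partial> t \<subset> \<phi> t\<close>.\<close>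

lemma inj_on_support: "inj_on \<phi> support"
proof (rule inj_onI, rule ccontr)
  fix s t assume st: "s \<in> support" "t \<in> support" "\<phi> s = \<phi> t" "s \<noteq> t"
  obtain x where x: "x \<in> Y" "x \<in> \<phi> s" "degree x = s" using support_has_element[OF st(1)] .
  have t: "t \<in> carrier M" "\<phi> t \<noteq> \<partial> t" using st(2) by (auto simp: support_def)
  have "x \<in> \<partial> t" using degree_eqI[OF x(1) t(1)] x st by auto
  then have "\<phi> s \<subseteq> \<partial> t" using degree_subset_lattice boundary_lattice t(1) x by blast
  then show False using boundary_subset t st(3) by blast
qed

lemma finite_support: "finite support"
proof (rule finite_imageD[OF _ inj_on_support])
  show "finite (\<phi> ` support)"
    by (rule finite_subset[OF _ finite_image]) (auto simp: support_def)
qed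

lemma layer_product_lattice:
  assumes "set vs \<subseteq> carrier M"
  shows "layer_product G \<phi> vs \<in> lattice \<and> layer_product G \<phi> vs \<inter> Y = (\<Union>s \<in> set vs. \<phi> s) \<inter> Y"
  using assms
proof (induction vs)
  case Nil
  then show ?case using one_in_lattice one_notin_Y by simp
next
  case (Cons s vs)
  then have "\<phi> s \<in> lattice" "layer_product G \<phi> vs \<in> lattice" by (auto intro: filter_lattice.base)
  then show ?case using Cons filter_lattice.mult set_mult_Int_Y by auto
qed

text \<open>Both sides are determined by their elements \<open>x\<close> in \<open>Y\<close>. If such an \<open>x\<close> on the left were outside
  \<open>\<partial> s\<close>, it would have degree \<open>s\<close>, and \<open>\<phi> s\<close> would be contained in a later \<open>\<phi> t\<close>. If \<open>x \<in> \<partial> s\<close>,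
  then \<open>\<phi>\<close> at the degree of \<open>x\<close> is properly below \<open>\<phi> s\<close>, so this degree comes later in the list.\<close>

lemma support_layer_meet:
  assumes ss: "set (us @ s # vs) = support" "sorted_wrt (\<lambda>s t. \<not> \<phi> s \<subseteq> \<phi> t) (us @ s # vs)"
  shows "\<phi> s \<inter> layer_product G \<phi> vs = \<partial> s"
proof (rule lattice_eqI)
  have s: "s \<in> carrier M" "\<phi> s \<noteq> \<partial> s" and vs: "set vs \<subseteq> carrier M"
    using ss(1) by (auto simp: support_def)
  show "\<phi> s \<inter> layer_product G \<phi> vs \<in> lattice"
    using layer_product_lattice[OF vs] s by (auto intro: filter_lattice.intros)
  show boundary: "\<partial> s \<in> lattice" using s by (intro boundary_lattice)
  have below: "\<not> \<phi> s \<subseteq> \<phi> t" if "t \<in> set vs" for t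
    using ss(2) that by (auto simp: sorted_wrt_append)
  have above: "\<not> \<phi> t \<subseteq> \<phi> s" if "t \<in> set us" for t
    using ss(2) that by (auto simp: sorted_wrt_append)
  have "x \<in> \<partial> s" if x: "x \<in> Y" "x \<in> \<phi> s" "x \<in> \<phi> t" and t: "t \<in> set vs" for x t
  proof (rule ccontr)
    assume "x \<notin> \<partial> s"
    then have "degree x = s" using degree_eqI s(1) x by simp
    then have "\<phi> s \<subseteq> \<phi> t" using degree_subset_lattice[of "\<phi> t" x] x t vs by (auto intro: filter_lattice.base)
    then show False using below t by blast
  qed
  moreover have "\<exists>t \<in> set vs. x \<in> \<phi> t" if x: "x \<in> Y" "x \<in> \<partial> s" for x
  proof
    show "x \<in> \<phi> (degree x)" using degree x(1) by blast
    have "\<phi> (degree x) \<subseteq> \<partial> s" using degree_subset_lattice boundary x by blast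
    then have "\<phi> (degree x) \<subseteq> \<phi> s" "degree x \<noteq> s" using boundary_subset s by auto
    then show "degree x \<in> set vs" using degree_in_support[OF x(1)] ss(1) above by auto
  qed
  ultimately have "\<phi> s \<inter> ((\<Union>t \<in> set vs. \<phi> t) \<inter> Y) = \<partial> s \<inter> Y"
    using boundary_subset[OF s(1)] by (intro equalityI subsetI) auto
  then show "\<phi> s \<inter> layer_product G \<phi> vs \<inter> Y = \<partial> s \<inter> Y"
    using layer_product_lattice[OF vs] by (simp add: Int_assoc)
qed

text \<open>Every element of \<open>Y\<close> lies in the layer of its degree, and \<open>Y\<close> generates \<open>G\<close>.\<close>

lemma layer_product_support:
  assumes "set ss = support" shows "layer_product G \<phi> ss = carrier G"
proof -
  have ss: "set ss \<subseteq> carrier M" using assms by (auto simp: support_def)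
  have "Y \<subseteq> (\<Union>s \<in> set ss. \<phi> s)" using degree_in_support degree assms by blast
  then have "layer_product G \<phi> ss \<inter> Y = \<phi> \<one> \<inter> Y"
    using conjunct2[OF layer_product_lattice[OF ss]] Y_carrier boundary_one(2)
    by (simp add: Int_absorb1)
  then have "layer_product G \<phi> ss = \<phi> \<one>"
    by (rule lattice_eqI[OF conjunct1[OF layer_product_lattice[OF ss]] filter_lattice.base[OF one_closed]])
  then show ?thesis using boundary_one(2) by simp
qed

lemma commutator_mem_boundary:
  assumes "s \<in> carrier M" "s \<noteq> \<one>" "x \<in> \<phi> s" "y \<in> \<phi> s"
  shows "x \<otimes>\<^bsub>G\<^esub> y \<otimes>\<^bsub>G\<^esub> inv\<^bsub>G\<^esub> x \<otimes>\<^bsub>G\<^esub> inv\<^bsub>G\<^esub> y \<in> \<partial> s"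
proof -
  have "x \<otimes>\<^bsub>G\<^esub> y \<otimes>\<^bsub>G\<^esub> inv\<^bsub>G\<^esub> x \<otimes>\<^bsub>G\<^esub> inv\<^bsub>G\<^esub> y \<in> commutator_subgroup G (\<phi> s) (\<phi> s)"
    using assms unfolding commutator_subgroup_def by (intro generate.incl) auto
  then have "x \<otimes>\<^bsub>G\<^esub> y \<otimes>\<^bsub>G\<^esub> inv\<^bsub>G\<^esub> x \<otimes>\<^bsub>G\<^esub> inv\<^bsub>G\<^esub> y \<in> \<phi> (s \<otimes> s)"
    using commutator assms(1) by blast
  then show ?thesis
    using assms(1,2) unfolding filter_boundary_def by (intro generate.incl) auto
qed

lemma layered_by_support:
  obtains ss where "set ss = support" "layered_group G \<phi> \<partial> ss"
proof -
  obtain ss where ss: "distinct ss" "set ss = support" "sorted_wrt (\<lambda>s t. \<not> \<phi> s \<subseteq> \<phi> t) ss"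
    using inclusion_antisorted_enumeration[OF finite_support inj_on_support] by blast
  have "layered_group G \<phi> \<partial> ss"
  proof (rule layered_group.intro[OF G.is_group layered_group_axioms.intro])
    show "distinct ss" by fact
    fix s assume "s \<in> set ss"
    then have s: "s \<in> carrier M" "s \<noteq> \<one>" using ss(2) by (auto simp: support_def)
    show "\<phi> s \<lhd> G" using s by (intro normal)
    show "\<partial> s \<lhd> G" using s by (intro lattice_normal boundary_lattice)
    fix x y assume "x \<in> \<phi> s" "y \<in> \<phi> s"
    with s show "x \<otimes>\<^bsub>G\<^esub> y \<otimes>\<^bsub>G\<^esub> inv\<^bsub>G\<^esub> x \<otimes>\<^bsub>G\<^esub> inv\<^bsub>G\<^esub> y \<in> \<partial> s" by (rule commutator_mem_boundary)
  next
    fix us s vs assume "ss = us @ s # vs"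
    then show "\<phi> s \<inter> layer_product G \<phi> vs = \<partial> s" using ss(2,3) by (intro support_layer_meet[of us]) auto
  qed
  then show thesis using that ss(2) by blast
qed

end

theorem theorem3:
  fixes M :: "('m, 'c) monoid_scheme"
    and le :: "'m \<Rightarrow> 'm \<Rightarrow> bool"
    and G :: "('a, 'b) monoid_scheme"
    and \<phi> :: "'m \<Rightarrow> 'a set"
  assumes "group G" and "fg_group G" and "nilpotent_group G"
    and "conically_preordered_monoid M le" and "fg_monoid M"
    and "group_filter M le G \<phi>"
    and "finite_filter M \<phi>" and "faithful_filter M G \<phi>" and "inertia_free M G \<phi>"
  shows "\<exists>f. bij_betw f (carrier (filter_sum M G \<phi>)) (carrier G) \<and>
             (\<exists>as. pcgs (filter_sum M G \<phi>) as \<and> pcgs G (map f as))"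
proof -
  interpret group_filter M le G \<phi> by fact
  obtain Y where "faithful_inertia_free_filter M le G \<phi> Y"
  proof -
    obtain Y where Y: "Y \<subseteq> carrier G"
      "\<forall>H \<in> filter_lattice M G \<phi>. generate G (H \<inter> Y) = H"
      "\<forall>H \<in> filter_lattice M G \<phi>. \<forall>K \<in> filter_lattice M G \<phi>.
         (H <#>\<^bsub>G\<^esub> K) \<inter> Y = (H \<inter> Y) \<union> (K \<inter> Y)"
      "\<forall>x \<in> Y. \<exists>!s. s \<in> carrier M \<and> x \<in> \<phi> s - filter_boundary M G \<phi> s"
      using \<open>faithful_filter M G \<phi>\<close> unfolding faithful_filter_def
      by (elim exE conjE) (rule that)
    show thesis
    proof (rule that, unfold_locales)
      show "finite (\<phi> ` carrier M)" using \<open>finite_filter M \<phi>\<close> by (simp add: finite_filter_def)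
      show "(\<Union>i. inertia_level M G \<phi> i) = \<phi> ` carrier M"
        using \<open>inertia_free M G \<phi>\<close> by (simp add: inertia_free_def)
      show "Y \<subseteq> carrier G" by fact
      show "generate G (H \<inter> Y) = H" if "H \<in> filter_lattice M G \<phi>" for H using Y(2) that by blast
      show "(H <#>\<^bsub>G\<^esub> K) \<inter> Y = (H \<inter> Y) \<union> (K \<inter> Y)"
        if "H \<in> filter_lattice M G \<phi>" "K \<in> filter_lattice M G \<phi>" for H K using Y(3) that by blast
      show "\<exists>!s. s \<in> carrier M \<and> x \<in> \<phi> s - filter_boundary M G \<phi> s" if "x \<in> Y" for x
        using Y(4) that by blast
    qed
  qed
  then interpret faithful_inertia_free_filter M le G \<phi> Y .
  obtain ss where ss: "set ss = support" and layers: "layered_group G \<phi> (filter_boundary M G \<phi>) ss"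
    using layered_by_support .
  have "noetherian_in G (carrier G)"
    using G.noetherian_of_fg_nilpotent assms(2,3) by blast
  then show ?thesis
    unfolding filter_sum_def
    using ss normal layer_product_support[OF ss]
    by (intro layered_group.bijection_of_pcgs[OF layers]) (auto simp: support_def)
qed

end
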